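(* Assume that $\ell(\cdot,b):\mathbb{R}^s\to\mathbb{R}$ is $L_\ell$-smooth and convex and that each $r_i:\mathbb{R}^{d_i}\to\mathbb{R}$ ($i=1,\dots,n$) is $L_r$-smooth and convex. Let the saddle point problem described in the context be solved by the algorithm with unbiased compression described there, with an operator $Q$ that is an unbiased compressor with constant $\omega\ge1$. Then for $\tau=1-p$ and $$\gamma=\frac14\min\left\{1;\ \frac1{L_r};\ \frac1{L_\ell};\ \sqrt{\frac{1-\tau}{\omega\,\lambda_{\max}(AA^T)}}\right\}$$ it holds that $$\mathbb{E}\left[\mathrm{gap}(\bar x^K,\bar z^K,\bar y^K)\right]=\mathcal{O}\left(\left[1+\sqrt{\frac{\omega}{p}}\,\sqrt{\lambda_{\max}(AA^T)}+L_\ell+L_r\right]\frac{D^2}{K}\right),$$ where $\bar x^K=\frac1K\sum_{k=0}^{K-1}x^{k+1/2}$, $\bar z^K=\frac1K\sum_{k=0}^{K-1}z^{k+1/2}$, $\bar y^K=\frac1K\sum_{k=0}^{K-1}y^{k+1/2}$ and $D^2=\max_{x\in\mathcal X,z\in\mathcal Z,y\in\mathcal Y}\left[\|x^0-x\|^2+\|z^0-z\|^2+\|y^0-y\|^2\right]$.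
   Context: Setting: $n,s,d_1,\dots,d_n$ are positive integers, $d=\sum_i d_i$, $A_i\in\mathbb{R}^{s\times d_i}$, $A=[A_1,\dots,A_n]\in\mathbb{R}^{s\times d}$, $b\in\mathbb{R}^s$ is fixed, and $x=(x_1,\dots,x_n)\in\mathbb{R}^d$ with $x_i\in\mathbb{R}^{d_i}$, so $Ax=\sum_iA_ix_i$. $\ell:\mathbb{R}^s\times\mathbb{R}^s\to\mathbb{R}$, and $\nabla\ell(z,b)$ is the gradient in the first argument. The saddle point problem is $\min_{(x,z)\in\mathbb{R}^{d+s}}\max_{y\in\mathbb{R}^s}L(x,z,y)$ with $$L(x,z,y)=\ell(z,b)+\sum_{i=1}^n r_i(x_i)+y^T\Big(\sum_{i=1}^nA_ix_i-z\Big).$$ $\mathcal X\subset\mathbb{R}^d$, $\mathcal Z\subset\mathbb{R}^s$, $\mathcal Y\subset\mathbb{R}^s$ are compact sets used only to define the convergence criterion $$\mathrm{gap}(x,z,y)=\max_{\tilde y\in\mathcal Y}L(x,z,\tilde y)-\min_{\tilde x\in\mathcal X,\tilde z\in\mathcal Z}L(\tilde x,\tilde z,y).$$ A function $f$ is $L$-smooth ($L>0$) if $\|\nabla f(u)-\nabla f(v)\|\le L\|u-v\|$ for all $u,v$. Norms are Euclidean; $\lambda_{\max}$ is the largest eigenvalue. A (random) operator $Q$ is an unbiased compressor with constant $\omega\ge1$ if $\mathbb{E}[Q(v)]=v$ and $\mathbb{E}\|Q(v)\|^2\le\omega\|v\|^2$ for all $v$. Algorithm ($n$ devices; device $i$ holds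 $A_i$ and $x_i$; the first device also holds $z$, $y$ and $b$): inputs are initial points $(x^0,z^0,y^0)\in\mathbb{R}^{d+2s}$ and $(w^0,u^0)\in\mathbb{R}^{d+s}$ with $w^0=(w_1^0,\dots,w_n^0)$, a stepsize $\gamma>0$, and the number of steps $K$; $p$ is a (positive) probability and $\tau$ a momentum parameter. For $k=0,\dots,K-1$: $x_i^{k+1/2}=\tau x_i^k+(1-\tau)w_i^k-\gamma(A_i^Tu^k+\nabla r_i(x_i^k))$ for all $i$; $z^{k+1/2}=z^k-\gamma(\nabla\ell(z^k,b)-y^k)$; $y^{k+1/2}=\tau y^k+(1-\tau)u^k+\gamma(\sum_iA_iw_i^k-z^k)$; the first device sends $Q(y^{k+1/2}-u^k)$ to the other devices, and each device $i$ sends $Q(A_ix_i^{k+1/2}-A_iw_i^k)$ to the first device; $x_i^{k+1}=\tau x_i^k+(1-\tau)w_i^k-\gamma\big(A_i^T[Q(y^{k+1/2}-u^k)+u^k]+\nabla r_i(x_i^{k+1/2})\big)$ for all $i$; $z^{k+1}=z^k-\gamma(\nabla\ell(z^{k+1/2},b)-y^{k+1/2})$; $y^{k+1}=\tau y^k+(1-\tau)u^k+\gamma\big(\sum_i[Q(A_ix_i^{k+1/2}-A_iw_i^k)+A_iw_i^k]-z^{k+1/2}\big)$; then flip a coin $b_k\in\{0,1\}$ with $\mathbb{P}\{b_k=1\}=p$; if $b_k=1$ set $w_i^{k+1}=x_i^k$ for all $i$ and $u^{k+1}=y^k$; otherwise $w_i^{k+1}=w_i^k$ for all $i$ and $u^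{k+1}=u^k$.
   Formalization: The claim fails for p near 1 and when w^0, u^0 are far from x^0, y^0 relative to D; the formal theorem assumes p ≤ 9/10 and ‖w^0−x^0‖²+‖u^0−y^0‖² ≤ R·D², and its O-constant is 1000(1+R). *)

theory Defs
  imports "HOL-Probability.Probability"
begin

definition gradient :: "('a::real_inner \<Rightarrow> real) \<Rightarrow> 'a \<Rightarrow> 'a" where
  "gradient f u = (THE g. GDERIV f u :> g)"

definition L_smooth :: "real \<Rightarrow> ('a::real_inner \<Rightarrow> real) \<Rightarrow> bool" where
  "L_smooth L f \<longleftrightarrow> 0 < L \<and> (\<forall>u. \<exists>g. GDERIV f u :> g) \<and>
     (\<forall>u v. norm (gradient f u - gradient f v) \<le> L * norm (u - v))"

text \<open>Used for symmetric matrices only; their set of real eigenvalues is finite and nonempty.\<close>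

definition lambda_max :: "real ^ 's ^ 's \<Rightarrow> real" where
  "lambda_max B = Max {c. \<exists>v. v \<noteq> 0 \<and> B *v v = c *\<^sub>R v}"


text \<open>
  The coordinates of \<open>x \<in> \<real>\<^sup>d\<close> are indexed by the type \<open>'d\<close>, the \<open>n\<close> devices by the type
  \<open>'n\<close>, and \<open>owner j\<close> is the device holding coordinate \<open>j\<close>. If \<open>owner\<close> is surjective, the
  fibre over \<open>i\<close> has some size \<open>d\<^sub>i \<ge> 1\<close>, and every choice of \<open>n, d\<^sub>1, \<dots>, d\<^sub>n\<close> arises
  this way. The \<open>d\<^sub>i\<close>-dimensional factor is identified with the vectors supported on that
  fibre: \<open>x\<^sub>i\<close> becomes \<open>block owner i x\<close>, the product \<open>A\<^sub>i x\<^sub>i\<close> becomes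
  \<open>A *v block owner i x\<close>, the vector \<open>A\<^sub>i\<^sup>T u\<close> becomes \<open>block owner i (transpose A *v u)\<close>,
  and concatenating blocks is adding them up.
\<close>

definition block :: "('d \<Rightarrow> 'n) \<Rightarrow> 'n \<Rightarrow> real ^ 'd \<Rightarrow> real ^ 'd" where
  "block own i x = (\<chi> j. if own j = i then x $ j else 0)"

text \<open>
  A function of \<open>x\<^sub>i\<close> alone is a function on \<open>\<real>\<^sup>d\<close> ignoring all coordinates outside block
  \<open>i\<close>. Its gradient, its convexity and its smoothness constant are those of the function on the
  \<open>d\<^sub>i\<close>-dimensional space, up to the identification above.
\<close>

definition depends_on_block :: "('d \<Rightarrow> 'n) \<Rightarrow> 'n \<Rightarrow> (real ^ 'd \<Rightarrow> real) \<Rightarrow> bool" where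
  "depends_on_block own i f \<longleftrightarrow> (\<forall>x. f x = f (block own i x))"

record ('d::finite, 's::finite, 'n::finite) problem =
  features :: "real ^ 'd ^ 's"
  owner :: "'d \<Rightarrow> 'n"
  reg :: "'n \<Rightarrow> real ^ 'd \<Rightarrow> real"
  loss :: "real ^ 's \<Rightarrow> real ^ 's \<Rightarrow> real"
  label :: "real ^ 's"

definition lagrangian ::
  "('d::finite, 's::finite, 'n::finite) problem \<Rightarrow> real ^ 'd \<Rightarrow> real ^ 's \<Rightarrow> real ^ 's \<Rightarrow> real"
where
  "lagrangian P x z y =
     loss P z (label P) + (\<Sum>i\<in>UNIV. reg P i (block (owner P) i x))
     + y \<bullet> ((\<Sum>i\<in>UNIV. features P *v block (owner P) i x) - z)"

text \<open>For nonempty compact sets and a continuous Lagrangian the extrema are attained.\<close>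

definition gap ::
  "('d::finite, 's::finite, 'n::finite) problem \<Rightarrow> (real ^ 'd) set \<Rightarrow> (real ^ 's) set \<Rightarrow>
   (real ^ 's) set \<Rightarrow> real ^ 'd \<Rightarrow> real ^ 's \<Rightarrow> real ^ 's \<Rightarrow> real"
where
  "gap P X Z Y x z y =
     (SUP y'\<in>Y. lagrangian P x z y') - (INF (x', z')\<in>X \<times> Z. lagrangian P x' z' y)"

definition max_sq_dist ::
  "(real ^ 'd) set \<Rightarrow> (real ^ 's) set \<Rightarrow> (real ^ 's) set \<Rightarrow> real ^ 'd \<Rightarrow> real ^ 's \<Rightarrow> real ^ 's \<Rightarrow> real"
where
  "max_sq_dist X Z Y x0 z0 y0 =
     (SUP (x, z, y)\<in>X \<times> Z \<times> Y. (norm (x0 - x))\<^sup>2 + (norm (z0 - z))\<^sup>2 + (norm (y0 - y))\<^sup>2)"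


text \<open>
  A random operator is \<open>Q\<close> applied to a random seed distributed according to \<open>S\<close>. Joint
  measurability is what makes \<open>Q\<close> at a random argument a random variable.
\<close>

definition unbiased_compressor ::
  "'q measure \<Rightarrow> ('q \<Rightarrow> real ^ 's \<Rightarrow> real ^ 's) \<Rightarrow> real \<Rightarrow> bool"
where
  "unbiased_compressor S Q om \<longleftrightarrow>
     1 \<le> om \<and> prob_space S \<and> (\<lambda>(q, v). Q q v) \<in> S \<Otimes>\<^sub>M borel \<rightarrow>\<^sub>M borel \<and>
     (\<forall>v. integrable S (\<lambda>q. Q q v) \<and> (\<integral>q. Q q v \<partial>S) = v \<and>
          integrable S (\<lambda>q. (norm (Q q v))\<^sup>2) \<and> (\<integral>q. (norm (Q q v))\<^sup>2 \<partial>S) \<le> om * (norm v)\<^sup>2)"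

text \<open>
  In iteration \<open>k\<close>, \<open>bc k\<close> is the seed of the single message of the first device to the others,
  \<open>up k i\<close> the seed of the message of device \<open>i\<close> to the first device, and \<open>coin k\<close> the coin. All
  of these random variables, over all iterations and devices, are mutually independent.
\<close>

datatype 'n source = Broadcast nat | Upload nat 'n | Coin nat

definition algorithm_randomness ::
  "'w measure \<Rightarrow> 'q measure \<Rightarrow> real \<Rightarrow> (nat \<Rightarrow> 'w \<Rightarrow> 'q) \<Rightarrow> (nat \<Rightarrow> 'n \<Rightarrow> 'w \<Rightarrow> 'q) \<Rightarrow>
   (nat \<Rightarrow> 'w \<Rightarrow> bool) \<Rightarrow> bool"
where
  "algorithm_randomness M S p bc up coin \<longleftrightarrow>
     prob_space M \<and>
     (\<forall>k. bc k \<in> M \<rightarrow>\<^sub>M S \<and> distr M S (bc k) = S) \<and>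
     (\<forall>k i. up k i \<in> M \<rightarrow>\<^sub>M S \<and> distr M S (up k i) = S) \<and>
     (\<forall>k. coin k \<in> M \<rightarrow>\<^sub>M count_space UNIV \<and> measure M {e \<in> space M. coin k e} = p) \<and>
     prob_space.indep_sets M
       (\<lambda>src. case src of
          Broadcast k \<Rightarrow> {bc k -` B \<inter> space M | B. B \<in> sets S}
        | Upload k i \<Rightarrow> {up k i -` B \<inter> space M | B. B \<in> sets S}
        | Coin k \<Rightarrow> {coin k -` B \<inter> space M | B. B \<in> UNIV})
       (UNIV :: 'n source set)"


record ('d::finite, 's::finite) state =
  xs :: "real ^ 'd"
  zs :: "real ^ 's"
  ys :: "real ^ 's"
  ws :: "real ^ 'd"
  us :: "real ^ 's"

definition x_half ::
  "('d::finite, 's::finite, 'n::finite) problem \<Rightarrow> real \<Rightarrow> real \<Rightarrow> ('d, 's) state \<Rightarrow> real ^ 'd"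
where
  "x_half P \<tau> \<gamma> s =
     \<tau> *\<^sub>R xs s + (1 - \<tau>) *\<^sub>R ws s
     - \<gamma> *\<^sub>R (\<Sum>i\<in>UNIV. block (owner P) i (transpose (features P) *v us s)
                         + gradient (reg P i) (block (owner P) i (xs s)))"

definition z_half ::
  "('d::finite, 's::finite, 'n::finite) problem \<Rightarrow> real \<Rightarrow> ('d, 's) state \<Rightarrow> real ^ 's"
where
  "z_half P \<gamma> s = zs s - \<gamma> *\<^sub>R (gradient (\<lambda>z. loss P z (label P)) (zs s) - ys s)"

definition y_half ::
  "('d::finite, 's::finite, 'n::finite) problem \<Rightarrow> real \<Rightarrow> real \<Rightarrow> ('d, 's) state \<Rightarrow> real ^ 's"
where
  "y_half P \<tau> \<gamma> s =
     \<tau> *\<^sub>R ys s + (1 - \<tau>) *\<^sub>R us s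
     + \<gamma> *\<^sub>R ((\<Sum>i\<in>UNIV. features P *v block (owner P) i (ws s)) - zs s)"

text \<open>
  One iteration, given the realisation \<open>q0\<close> of the operator used by the first device for its
  message to the others, the realisations \<open>q i\<close> used by device \<open>i\<close>, and the outcome of the coin.
\<close>

definition next_state ::
  "('d::finite, 's::finite, 'n::finite) problem \<Rightarrow> real \<Rightarrow> real \<Rightarrow>
   (real ^ 's \<Rightarrow> real ^ 's) \<Rightarrow> ('n \<Rightarrow> real ^ 's \<Rightarrow> real ^ 's) \<Rightarrow> bool \<Rightarrow>
   ('d, 's) state \<Rightarrow> ('d, 's) state"
where
  "next_state P \<tau> \<gamma> q0 q heads s =
     (let xh = x_half P \<tau> \<gamma> s; zh = z_half P \<gamma> s; yh = y_half P \<tau> \<gamma> s in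
      \<lparr> xs = \<tau> *\<^sub>R xs s + (1 - \<tau>) *\<^sub>R ws s
              - \<gamma> *\<^sub>R (\<Sum>i\<in>UNIV.
                    block (owner P) i (transpose (features P) *v (q0 (yh - us s) + us s))
                    + gradient (reg P i) (block (owner P) i xh)),
        zs = zs s - \<gamma> *\<^sub>R (gradient (\<lambda>z. loss P z (label P)) zh - yh),
        ys = \<tau> *\<^sub>R ys s + (1 - \<tau>) *\<^sub>R us s
              + \<gamma> *\<^sub>R ((\<Sum>i\<in>UNIV.
                    q i (features P *v block (owner P) i xh - features P *v block (owner P) i (ws s))
                    + features P *v block (owner P) i (ws s)) - zh),
        ws = (if heads then xs s else ws s),
        us = (if heads then ys s else us s) \<rparr>)"

primrec iterate ::
  "('d::finite, 's::finite, 'n::finite) problem \<Rightarrow> real \<Rightarrow> real \<Rightarrow>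
   (nat \<Rightarrow> real ^ 's \<Rightarrow> real ^ 's) \<Rightarrow> (nat \<Rightarrow> 'n \<Rightarrow> real ^ 's \<Rightarrow> real ^ 's) \<Rightarrow> (nat \<Rightarrow> bool) \<Rightarrow>
   ('d, 's) state \<Rightarrow> nat \<Rightarrow> ('d, 's) state"
where
  "iterate P \<tau> \<gamma> q0 q heads s0 0 = s0"
| "iterate P \<tau> \<gamma> q0 q heads s0 (Suc k) =
     next_state P \<tau> \<gamma> (q0 k) (q k) (heads k) (iterate P \<tau> \<gamma> q0 q heads s0 k)"

definition average :: "nat \<Rightarrow> (nat \<Rightarrow> 'a::real_vector) \<Rightarrow> 'a" where
  "average K v = (1 / real K) *\<^sub>R (\<Sum>k<K. v k)"

text \<open>
  \<open>lam\<close> stands for \<open>\<lambda>\<^sub>m\<^sub>a\<^sub>x(AA\<^sup>T) \<ge> 0\<close>. If it vanishes, the fourth term of the minimum is infinite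
  and plays no role; division by zero in HOL would instead turn it into 0.
\<close>

definition stepsize :: "real \<Rightarrow> real \<Rightarrow> real \<Rightarrow> real \<Rightarrow> real \<Rightarrow> real" where
  "stepsize Lr Ll \<tau> om lam =
     1 / 4 * Min ({1, 1 / Lr, 1 / Ll} \<union>
                  (if lam = 0 then {} else {sqrt ((1 - \<tau>) / (om * lam))}))"

end

theory Submission
  imports Defs
begin

text \<open>
  Every update is an extragradient step \<open>x\<^sup>+ = (1 - p) x + p w - \<gamma> (g + n)\<close> in which \<open>n\<close> is the
  mean-zero compression noise, so \<open>2 \<gamma> \<langle>g, x\<^sup>h - X\<rangle>\<close> telescopes in
  \<open>|x - X|\<^sup>2 + |w - X|\<^sup>2\<close>, up to errors absorbed by \<open>(1 - p) |x\<^sup>h - x|\<^sup>2 + p |x\<^sup>h - w|\<^sup>2\<close>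
  and up to noise. The gap compares with a point \<open>X\<close> that depends on the noise, so one cannot take
  expectations for fixed \<open>X\<close>. However, the noise of the compressor and of the coin is affine in \<open>X\<close>:
  it is a mean-zero offset plus \<open>\<langle>S, X - x\<^sub>0\<rangle>\<close> with \<open>S\<close> a sum of martingale differences. Since
  \<open>\<langle>S, X - x\<^sub>0\<rangle> \<le> |S|\<^sup>2 / 100 + 25 |X - x\<^sub>0|\<^sup>2\<close>, it suffices to control \<open>E |S|\<^sup>2\<close>, the sum of the
  variances of the increments, and these are absorbed by the same negative terms, the variance
  \<open>4 p (1 - p) |x - w|\<^sup>2\<close> of the coin because it is at most four times their sum. The smoothness error
  \<open>\<gamma>\<^sup>2 L\<^sup>2 |x\<^sup>h - x|\<^sup>2\<close> does not shrink with \<open>1 - p\<close>, which is why \<open>1 - p\<close> must stay away from zero.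
\<close>

section \<open>Eigenvalues, gradients and blocks\<close>

text \<open>The compressors act on the differences \<open>yh - u\<close> and
  \<open>A i (xh - w)\<close>, not on the iterates, so their variances are proportional to |yh -
  u|^2 and |xh - w|^2, which occur with factor -p in the extragradient identities. The absorption is
  crossed: broadcast noise perturbs x but is paid for by the y identity, upload noise perturbs y and
  is paid for by the x identity. Hence one iteration has to be treated as a whole, and the stepsize
  must satisfy \<gamma>^2 om lam <= p / 16. The term 1 in the stepsize covers the coupling of z with
  y, an operator of norm one. A vanishing conditional mean is expressed as orthogonality to every
  square integrable vector known beforehand. This suffices for martingale increments and also allows
  conditioning on part of a single iteration, as the messages of different devices require. The gap
  is bounded for each outcome by a random variable free of the comparator; expectations are taken
  only after that.\<close>

lemma rayleigh_le_lambda_max: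
  fixes B :: "real ^ 's ^ 's"
  assumes sym: "transpose B = B"
  shows "v \<bullet> (B *v v) \<le> lambda_max B * (norm v)\<^sup>2"
proof -
  let ?E = "{c. \<exists>v. v \<noteq> 0 \<and> B *v v = c *\<^sub>R v}"
  have adj: "(B *v a) \<bullet> b = a \<bullet> (B *v b)" for a b
    using dot_lmul_matrix[of a B b] transpose_matrix_vector[of B a] sym by simp
  \<comment> \<open>\<open>lambda_max\<close> is a \<open>Max\<close>, so the spectrum must be
    finite. Eigenvectors of distinct eigenvalues are orthogonal; one chosen eigenvector per
    eigenvalue gives an orthogonal and hence finite family.\<close>
  have fin: "finite ?E"
  proof -
    define ev where "ev c = (SOME v. v \<noteq> 0 \<and> B *v v = c *\<^sub>R v)" for c
    have ev: "ev c \<noteq> 0 \<and> B *v ev c = c *\<^sub>R ev c" if "c \<in> ?E" for c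
      unfolding ev_def by (rule someI_ex) (use that in blast)
    have orth: "ev c \<bullet> ev d = 0" if "c \<in> ?E" "d \<in> ?E" "c \<noteq> d" for c d
    proof -
      have "c * (ev c \<bullet> ev d) = d * (ev c \<bullet> ev d)"
        using adj[of "ev c" "ev d"] ev[OF that(1)] ev[OF that(2)] by simp
      with that(3) show ?thesis by simp
    qed
    have "pairwise orthogonal (ev ` ?E)"
      unfolding pairwise_def orthogonal_def using orth by (metis (no_types, lifting) imageE)
    then have "finite (ev ` ?E)" by (rule pairwise_orthogonal_imp_finite)
    moreover have "inj_on ev ?E"
    proof (rule inj_onI, rule ccontr)
      fix c d assume cd: "c \<in> ?E" "d \<in> ?E" "ev c = ev d" "c \<noteq> d"
      have "ev c \<bullet> ev c = 0" using orth[OF cd(1,2,4)] unfolding cd(3) .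
      with ev[OF cd(1)] show False by simp
    qed
    ultimately show ?thesis by (rule finite_imageD)
  qed
  have bl: "bounded_linear ((*v) B)" by (rule matrix_vector_mul_bounded_linear)
  have cont: "continuous_on (sphere 0 1) (\<lambda>v. v \<bullet> (B *v v))"
    by (intro continuous_intros linear_continuous_on bl)
  have "sphere (0::real^'s) 1 \<noteq> {}" by (simp add: sphere_eq_empty)
  then obtain m where m: "norm m = 1" and max: "\<And>v. norm v = 1 \<Longrightarrow> v \<bullet> (B *v v) \<le> m \<bullet> (B *v m)"
    using continuous_attains_sup[OF compact_sphere _ cont] by (metis dist_0_norm mem_sphere)
  define \<mu> where "\<mu> = m \<bullet> (B *v m)"
  have le: "v \<bullet> (B *v v) \<le> \<mu> * (norm v)\<^sup>2" for v
  proof (cases "v = 0")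
    case False
    have "((1 / norm v) *\<^sub>R v) \<bullet> (B *v ((1 / norm v) *\<^sub>R v)) \<le> \<mu>"
      unfolding \<mu>_def using False by (intro max) simp
    then show ?thesis using False
      by (simp add: matrix_vector_mult_scaleR field_simps power2_eq_square)
  qed simp
  \<comment> \<open>A maximiser of the Rayleigh quotient is an eigenvector: the first variation vanishes.\<close>
  have "h \<bullet> (B *v m - \<mu> *\<^sub>R m) = 0" for h
  proof (rule ccontr)
    define b where "b = h \<bullet> (B *v m - \<mu> *\<^sub>R m)"
    define c where "c = h \<bullet> (B *v h) - \<mu> * (norm h)\<^sup>2"
    assume "h \<bullet> (B *v m - \<mu> *\<^sub>R m) \<noteq> 0"
    then have b: "b \<noteq> 0" by (simp add: b_def)
    have q: "2 * t * b + t\<^sup>2 * c \<le> 0" for t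
    proof -
      have "(m + t *\<^sub>R h) \<bullet> (B *v (m + t *\<^sub>R h)) - \<mu> * (norm (m + t *\<^sub>R h))\<^sup>2 \<le> 0"
        using le by simp
      moreover have "m \<bullet> (B *v h) = h \<bullet> (B *v m)"
        using adj[of h m] adj[of m h] by (simp add: inner_commute)
      moreover have "m \<bullet> m = 1" using m by (simp add: norm_eq_1)
      ultimately show ?thesis
        unfolding b_def c_def power2_norm_eq_inner \<mu>_def
        by (simp add: matrix_vector_right_distrib matrix_vector_mult_scaleR inner_simps
            inner_commute[of h m] algebra_simps power2_eq_square)
    qed
    \<comment> \<open>At \<open>t = b / e\<close> the linear part equals
      \<open>2 * t\<^sup>2 * e\<close>, so the expression in \<open>q\<close> becomes
      \<open>t\<^sup>2 * (2 * e + c)\<close>. Any \<open>e > 0\<close> with \<open>e + c > 0\<close>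
      makes it positive, against \<open>q\<close>.\<close>
    define e where "e = \<bar>c\<bar> + 1"
    have e: "e > 0" "e + c > 0" by (auto simp: e_def)
    have "2 * (b / e) * b + (b / e)\<^sup>2 * c = (b / e)\<^sup>2 * e + (b / e)\<^sup>2 * (e + c)"
      using e(1) by (simp add: field_simps power2_eq_square)
    moreover have "(b / e)\<^sup>2 * e > 0" "(b / e)\<^sup>2 * (e + c) > 0"
      using b e by (auto intro!: mult_pos_pos)
    ultimately show False using q[of "b / e"] by linarith
  qed
  then have "B *v m = \<mu> *\<^sub>R m" using inner_eq_zero_iff[of "B *v m - \<mu> *\<^sub>R m"] by auto
  moreover have "m \<noteq> 0" using m by auto
  ultimately have "\<mu> \<in> ?E" by auto
  then have "\<mu> \<le> lambda_max B" unfolding lambda_max_def using fin by simp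
  then show ?thesis using le[of v] by (meson mult_right_mono order_trans zero_le_power2)
qed

lemma adjoint_transpose_inner:
  fixes A :: "real ^ 'd ^ 's"
  shows "(transpose A *v y) \<bullet> x = y \<bullet> (A *v x)"
  by (metis dot_lmul_matrix transpose_matrix_vector)

lemma norm_transpose_mult_le:
  fixes A :: "real ^ 'd ^ 's"
  shows "(norm (transpose A *v y))\<^sup>2 \<le> lambda_max (A ** transpose A) * (norm y)\<^sup>2"
proof -
  have "(norm (transpose A *v y))\<^sup>2 = y \<bullet> ((A ** transpose A) *v y)"
    unfolding power2_norm_eq_inner adjoint_transpose_inner by (simp only: matrix_vector_mul_assoc)
  also have "\<dots> \<le> lambda_max (A ** transpose A) * (norm y)\<^sup>2"
    by (rule rayleigh_le_lambda_max) (simp add: matrix_transpose_mul)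
  finally show ?thesis .
qed

lemma lambda_max_nonneg:
  fixes A :: "real ^ 'd ^ 's"
  shows "0 \<le> lambda_max (A ** transpose A)"
proof -
  obtain y :: "real ^ 's" where "norm y = 1" using vector_choose_size[of 1] by auto
  then show ?thesis using norm_transpose_mult_le[of A y]
    by (simp add: order_trans[OF zero_le_power2])
qed

text \<open>The spectrum of the other Gram matrix is avoided: |A x|^4 is the squared inner product
  of x with the transpose applied to A x, so Cauchy-Schwarz and the bound for the transpose give |A
  x|^4 <= |x|^2 lam |A x|^2, and one factor cancels.\<close>

lemma norm_matrix_mult_le:
  fixes A :: "real ^ 'd ^ 's"
  shows "(norm (A *v x))\<^sup>2 \<le> lambda_max (A ** transpose A) * (norm x)\<^sup>2"
proof (cases "A *v x = 0")
  case False
  let ?l = "lambda_max (A ** transpose A)"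
  have "((norm (A *v x))\<^sup>2)\<^sup>2 = (x \<bullet> (transpose A *v (A *v x)))\<^sup>2"
    using adjoint_transpose_inner[of A "A *v x" x] by (simp add: power2_norm_eq_inner inner_commute)
  also have "\<dots> \<le> (norm x * norm (transpose A *v (A *v x)))\<^sup>2"
    by (metis Cauchy_Schwarz_ineq2 abs_ge_zero power2_abs power_mono)
  also have "\<dots> \<le> (norm x)\<^sup>2 * (?l * (norm (A *v x))\<^sup>2)"
    unfolding power_mult_distrib by (intro mult_left_mono norm_transpose_mult_le) auto
  finally have "(norm (A *v x))\<^sup>2 * (norm (A *v x))\<^sup>2 \<le> (?l * (norm x)\<^sup>2) * (norm (A *v x))\<^sup>2"
    by (simp only: power2_eq_square ac_simps)
  moreover have "(norm (A *v x))\<^sup>2 > 0" using False by simp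
  ultimately show ?thesis by (rule mult_right_le_imp_le)
qed (simp add: lambda_max_nonneg)

section \<open>Gradients and the tangent inequality of convex functions\<close>

lemma gradient_eqI: "GDERIV f u :> g \<Longrightarrow> gradient f u = g"
proof -
  assume g: "GDERIV f u :> g"
  have "g' = g" if "GDERIV f u :> g'" for g'
  proof -
    have "(\<lambda>h. h \<bullet> g') = (\<lambda>h. h \<bullet> g)"
      using that g unfolding gderiv_def by (rule has_derivative_unique)
    then show ?thesis by (metis vector_eq_rdot inner_commute)
  qed
  with g show ?thesis unfolding gradient_def by (intro the_equality)
qed

text \<open>Restriction to the line through x and y reduces this to a convex function of one real
  variable, which lies above its tangent at 0.\<close>

lemma convex_gradient_inequality:
  fixes f :: "'a::real_inner \<Rightarrow> real"
  assumes conv: "convex_on UNIV f" and der: "GDERIV f x :> g"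
  shows "f x + g \<bullet> (y - x) \<le> f y"
proof -
  define \<phi> where "\<phi> t = f (x + t *\<^sub>R (y - x))" for t
  have "convex_on UNIV \<phi>"
  proof (rule convex_onI)
    fix t a b :: real assume t: "0 < t" "t < 1"
    have "x + ((1 - t) *\<^sub>R a + t *\<^sub>R b) *\<^sub>R (y - x)
        = (1 - t) *\<^sub>R (x + a *\<^sub>R (y - x)) + t *\<^sub>R (x + b *\<^sub>R (y - x))"
      by (simp add: algebra_simps)
    then show "\<phi> ((1 - t) *\<^sub>R a + t *\<^sub>R b) \<le> (1 - t) * \<phi> a + t * \<phi> b"
      unfolding \<phi>_def using convex_onD[OF conv, of t] t by simp
  qed simp
  moreover have "(\<phi> has_real_derivative g \<bullet> (y - x)) (at 0)"
  proof -
    have "((\<lambda>t. x + t *\<^sub>R (y - x)) has_derivative (\<lambda>t. t *\<^sub>R (y - x))) (at 0)"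
      by (auto intro!: derivative_eq_intros)
    moreover have "(f has_derivative (\<lambda>h. h \<bullet> g)) (at (x + 0 *\<^sub>R (y - x)))"
      using der by (simp add: gderiv_def inner_commute)
    ultimately have "((\<lambda>t. f (x + t *\<^sub>R (y - x))) has_derivative (\<lambda>t. (t *\<^sub>R (y - x)) \<bullet> g)) (at 0)"
      by (rule has_derivative_compose)
    then show ?thesis unfolding \<phi>_def has_field_derivative_def
      by (rule has_derivative_eq_rhs) (auto simp: inner_commute mult.commute)
  qed
  ultimately have "\<phi> 1 - \<phi> 0 \<ge> (g \<bullet> (y - x)) * (1 - 0)"
    by (intro convex_on_imp_above_tangent[of UNIV]) auto
  then show ?thesis by (simp add: \<phi>_def)
qed

lemma L_smooth_GDERIV: "L_smooth L f \<Longrightarrow> GDERIV f u :> gradient f u"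
  unfolding L_smooth_def by (metis gradient_eqI)

section \<open>Orthogonal decomposition into blocks\<close>

lemma sum_block: "(\<Sum>i\<in>UNIV. block own i x) = (x :: real ^ 'd)" for own :: "'d::finite \<Rightarrow> 'n::finite"
  by (simp add: block_def vec_eq_iff)

lemma linear_block: "linear (block own i)"
  by (rule linearI) (auto simp: block_def vec_eq_iff)

lemma block_block: "block own i (block own j x) = (if i = j then block own i x else 0)"
  by (auto simp: block_def vec_eq_iff)

lemma inner_block: "block own i x \<bullet> y = x \<bullet> block own i y"
  unfolding inner_vec_def block_def by (intro sum.cong) auto

lemma norm_sum_block_fun:
  fixes own :: "'d::finite \<Rightarrow> 'n::finite"
  shows "(norm (\<Sum>i\<in>UNIV. block own i (f i)))\<^sup>2 = (\<Sum>i\<in>UNIV. (norm (block own i (f i)))\<^sup>2)"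
proof -
  have "block own i (\<Sum>j\<in>UNIV. block own j (f j)) = block own i (f i)" for i
    by (simp add: linear_sum[OF linear_block] block_block sum.If_cases)
  then show ?thesis
    unfolding power2_norm_eq_inner
    by (subst inner_sum_left, intro sum.cong refl) (metis block_block inner_block)
qed

lemma sum_norm_block: "(\<Sum>i\<in>UNIV. (norm (block own i x))\<^sup>2) = (norm x)\<^sup>2"
  for own :: "'d::finite \<Rightarrow> 'n::finite"
  by (simp add: norm_sum_block_fun[symmetric] sum_block)

text \<open>Since \<open>f\<close> equals its composition with the projection
  \<open>block own i\<close>, the chain rule and the self-adjointness of the projection put the
  gradient into its range. Gradients of different devices are therefore orthogonal.\<close>

lemma block_gradient_depends_on_block:
  assumes dep: "depends_on_block own i f" and smooth: "L_smooth L f"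
  shows "block own i (gradient f (block own i x)) = gradient f (block own i x)"
proof -
  have *: "gradient f x = block own i (gradient f (block own i x))" for x
  proof (rule gradient_eqI)
    have "(block own i has_derivative block own i) (at x)"
      by (intro linear_imp_has_derivative linear_block)
    then have "((\<lambda>x. f (block own i x)) has_derivative (\<lambda>h. gradient f (block own i x) \<bullet> block own i h)) (at x)"
    proof (rule has_derivative_compose)
      show "(f has_derivative (\<lambda>h. gradient f (block own i x) \<bullet> h)) (at (block own i x))"
        using L_smooth_GDERIV[OF smooth, of "block own i x"]
        by (simp add: gderiv_def inner_commute[of _ "gradient f (block own i x)"])
    qed
    then show "GDERIV f x :> block own i (gradient f (block own i x))"
    proof -
      assume "((\<lambda>x. f (block own i x)) has_derivative
        (\<lambda>h. gradient f (block own i x) \<bullet> block own i h)) (at x)"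
      moreover have "(\<lambda>x. f (block own i x)) = f"
        using dep by (auto simp: depends_on_block_def)
      moreover have "(\<lambda>h. gradient f (block own i x) \<bullet> block own i h)
          = (\<lambda>h. h \<bullet> block own i (gradient f (block own i x)))"
        by (rule ext) (metis inner_block inner_commute)
      ultimately show ?thesis by (simp add: gderiv_def)
    qed
  qed
  show "block own i (gradient f (block own i x)) = gradient f (block own i x)"
    using *[of "block own i x"] by (metis block_block)
qed

section \<open>Square integrable random vectors and independence\<close>

definition square_integrable :: "'w measure \<Rightarrow> ('w \<Rightarrow> 'a::euclidean_space) \<Rightarrow> bool" where
  "square_integrable M V \<longleftrightarrow> V \<in> borel_measurable M \<and> integrable M (\<lambda>e. (norm (V e))\<^sup>2)"

lemma square_integrable_measurable [measurable_dest]: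
  "square_integrable M V \<Longrightarrow> V \<in> borel_measurable M"
  by (simp add: square_integrable_def)

lemma square_integrable_norm: "square_integrable M V \<Longrightarrow> integrable M (\<lambda>e. (norm (V e))\<^sup>2)"
  by (simp add: square_integrable_def)

lemma square_integrable_bound:
  assumes "integrable M f" "V \<in> borel_measurable M" "\<And>e. (norm (V e))\<^sup>2 \<le> f e"
  shows "square_integrable M V"
  unfolding square_integrable_def
proof
  show "integrable M (\<lambda>e. (norm (V e))\<^sup>2)"
  proof (rule Bochner_Integration.integrable_bound[OF assms(1)])
    show "AE e in M. norm ((norm (V e))\<^sup>2) \<le> norm (f e)"
      using assms(3) by (intro AE_I2) (smt (verit) real_norm_def zero_le_power2)
  qed (use assms(2) in measurable)
qed fact

lemma norm_add_sq_le: "(norm (a + b))\<^sup>2 \<le> 2 * (norm a)\<^sup>2 + 2 * (norm b)\<^sup>2"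
  for a b :: "'a::real_inner"
proof -
  have "0 \<le> (norm (a - b))\<^sup>2" by simp
  then show ?thesis unfolding power2_norm_eq_inner by (simp add: inner_simps inner_commute)
qed

lemma abs_inner_le_sq: "\<bar>a \<bullet> b\<bar> \<le> (norm a)\<^sup>2 + (norm b)\<^sup>2" for a b :: "'a::real_inner"
proof -
  have "\<bar>a \<bullet> b\<bar> \<le> norm a * norm b" by (rule Cauchy_Schwarz_ineq2)
  also have "\<dots> \<le> (norm a)\<^sup>2 + (norm b)\<^sup>2"
    using sum_squares_bound[of "norm a" "norm b"] zero_le_power2[of "norm a"] zero_le_power2[of "norm b"]
    by linarith
  finally show ?thesis .
qed

lemma square_integrable_add:
  assumes "square_integrable M V" "square_integrable M W"
  shows "square_integrable M (\<lambda>e. V e + W e)"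
proof (rule square_integrable_bound)
  show "integrable M (\<lambda>e. 2 * (norm (V e))\<^sup>2 + 2 * (norm (W e))\<^sup>2)"
    using assms by (auto simp: square_integrable_def)
qed (use assms norm_add_sq_le in \<open>auto simp: square_integrable_def\<close>)

lemma square_integrable_scaleR:
  "square_integrable M V \<Longrightarrow> square_integrable M (\<lambda>e. c *\<^sub>R V e)"
  by (auto simp: square_integrable_def power_mult_distrib)

lemma square_integrable_minus:
  "square_integrable M V \<Longrightarrow> square_integrable M (\<lambda>e. - V e)"
  using square_integrable_scaleR[of M V "-1"] by simp

lemma square_integrable_diff:
  assumes "square_integrable M V" "square_integrable M W"
  shows "square_integrable M (\<lambda>e. V e - W e)"
  using square_integrable_add[OF assms(1) square_integrable_minus[OF assms(2)]] by simp

lemma (in finite_measure) square_integrable_const: "square_integrable M (\<lambda>e. c)"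
  by (simp add: square_integrable_def)

lemma (in finite_measure) square_integrable_sum:
  "(\<And>i. i \<in> I \<Longrightarrow> square_integrable M (V i)) \<Longrightarrow> square_integrable M (\<lambda>e. \<Sum>i\<in>I. V i e)"
  by (induction I rule: infinite_finite_induct)
    (auto intro: square_integrable_const square_integrable_add)

text \<open>A Lipschitz map grows at most linearly, and the constant \<open>g 0\<close> is square
  integrable because the measure is finite. This keeps the iterates square integrable although the
  gradients are nonlinear.\<close>

lemma (in finite_measure) square_integrable_lipschitz:
  assumes V: "square_integrable M V" and cont: "continuous_on UNIV g"
    and lip: "\<And>u v. norm (g u - g v) \<le> L * norm (u - v)"
  shows "square_integrable M (\<lambda>e. g (V e))"
proof -
  have "square_integrable M (\<lambda>e. g (V e) - g 0)"
  proof (rule square_integrable_bound)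
    show "integrable M (\<lambda>e. L\<^sup>2 * (norm (V e))\<^sup>2)" using V by (auto simp: square_integrable_def)
    show "(\<lambda>e. g (V e) - g 0) \<in> borel_measurable M"
      using V borel_measurable_continuous_onI[OF cont] by (auto simp: square_integrable_def)
    show "(norm (g (V e) - g 0))\<^sup>2 \<le> L\<^sup>2 * (norm (V e))\<^sup>2" for e
      using power_mono[OF lip[of "V e" 0] norm_ge_zero, of 2] by (simp add: power_mult_distrib)
  qed
  from square_integrable_add[OF this square_integrable_const[of "g 0"]] show ?thesis by simp
qed

lemma (in finite_measure) square_integrable_linear:
  assumes V: "square_integrable M V" and lin: "linear g"
  shows "square_integrable M (\<lambda>e. g (V e))"
proof (rule square_integrable_lipschitz[OF V])
  have bl: "bounded_linear g" using lin by (simp add: linear_conv_bounded_linear)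
  then show "continuous_on UNIV g" by (rule linear_continuous_on)
  show "norm (g u - g v) \<le> onorm g * norm (u - v)" for u v
    using onorm[OF bl, of "u - v"] by (simp add: linear_diff[OF lin])
qed

lemma square_integrable_inner:
  assumes "square_integrable M V" "square_integrable M W"
  shows "integrable M (\<lambda>e. V e \<bullet> W e)"
proof (rule Bochner_Integration.integrable_bound)
  show "integrable M (\<lambda>e. (norm (V e))\<^sup>2 + (norm (W e))\<^sup>2)"
    using assms by (auto simp: square_integrable_def)
  show "AE e in M. norm (V e \<bullet> W e) \<le> norm ((norm (V e))\<^sup>2 + (norm (W e))\<^sup>2)"
    using abs_inner_le_sq by (auto intro!: AE_I2)
qed (use assms in \<open>auto simp: square_integrable_def\<close>)

section \<open>Independence of the seeds and moments of compressed messages\<close>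

locale compression_noise =
  fixes M :: "'w measure" and S :: "'q measure" and Q :: "'q \<Rightarrow> real ^ 's \<Rightarrow> real ^ 's" and om p :: real
    and bc :: "nat \<Rightarrow> 'w \<Rightarrow> 'q" and up :: "nat \<Rightarrow> 'n::finite \<Rightarrow> 'w \<Rightarrow> 'q" and coin :: "nat \<Rightarrow> 'w \<Rightarrow> bool"
  assumes compressor: "unbiased_compressor S Q om"
    and randomness: "algorithm_randomness M S p bc up coin"
begin

sublocale prob_space M using randomness by (simp add: algorithm_randomness_def)

interpretation S: prob_space S using compressor by (simp add: unbiased_compressor_def)

lemma
  shows bc_measurable [measurable]: "bc k \<in> M \<rightarrow>\<^sub>M S" and distr_bc: "distr M S (bc k) = S"
    and up_measurable [measurable]: "up k i \<in> M \<rightarrow>\<^sub>M S" and distr_up: "distr M S (up k i) = S"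
    and coin_measurable [measurable]: "coin k \<in> M \<rightarrow>\<^sub>M count_space UNIV"
    and prob_coin: "prob {e \<in> space M. coin k e} = p"
  using randomness by (auto simp: algorithm_randomness_def)

lemma Q_measurable [measurable]: "(\<lambda>(q, v). Q q v) \<in> S \<Otimes>\<^sub>M borel \<rightarrow>\<^sub>M borel"
  using compressor by (simp add: unbiased_compressor_def)

lemma om_ge_1: "1 \<le> om"
  using compressor by (simp add: unbiased_compressor_def)

definition revealed :: "'n source \<Rightarrow> 'w set set" where
  "revealed src = (case src of
      Broadcast k \<Rightarrow> {bc k -` B \<inter> space M | B. B \<in> sets S}
    | Upload k i \<Rightarrow> {up k i -` B \<inter> space M | B. B \<in> sets S}
    | Coin k \<Rightarrow> {coin k -` B \<inter> space M | B. B \<in> UNIV})"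

text \<open>Packed as a measure so that \<open>V \<in> knowing J \<rightarrow>\<^sub>M N\<close> can
  say that V is determined by the sources in \<open>J\<close>. The index is a set of sources and not
  a time because the uploads within one iteration must be separated from each other.\<close>

definition knowing :: "'n source set \<Rightarrow> 'w measure" where
  "knowing J = sigma (space M) (\<Union>j\<in>J. revealed j)"

lemma revealed_events: "revealed src \<subseteq> events"
  unfolding revealed_def
  by (auto split: source.split intro!: measurable_sets[OF bc_measurable]
      measurable_sets[OF up_measurable] measurable_sets[OF coin_measurable])

lemma space_knowing [simp]: "space (knowing J) = space M"
  unfolding knowing_def
  by (rule space_measure_of) (use revealed_events sets.space_closed in blast)

lemma sets_knowing: "sets (knowing J) = sigma_sets (space M) (\<Union>j\<in>J. revealed j)"
  unfolding knowing_def by (rule sets_measure_of) (use revealed_events sets.space_closed in blast)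

lemma knowing_subset_events: "sets (knowing J) \<subseteq> events"
  unfolding sets_knowing using revealed_events by (intro sets.sigma_sets_subset) blast

lemma knowing_measurable: "V \<in> knowing J \<rightarrow>\<^sub>M N \<Longrightarrow> V \<in> M \<rightarrow>\<^sub>M N"
  using knowing_subset_events by (auto simp: measurable_def)

lemma knowing_mono: "J \<subseteq> J' \<Longrightarrow> V \<in> knowing J \<rightarrow>\<^sub>M N \<Longrightarrow> V \<in> knowing J' \<rightarrow>\<^sub>M N"
proof -
  assume "J \<subseteq> J'"
  then have "sets (knowing J) \<subseteq> sets (knowing J')"
    unfolding sets_knowing by (intro sigma_sets_mono') blast
  then show "V \<in> knowing J \<rightarrow>\<^sub>M N \<Longrightarrow> V \<in> knowing J' \<rightarrow>\<^sub>M N" by (auto simp: measurable_def)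
qed

lemma revealed_knowing: "src \<in> J \<Longrightarrow> revealed src \<subseteq> sets (knowing J)"
  unfolding sets_knowing by blast

lemma source_knowing:
  "Broadcast k \<in> J \<Longrightarrow> bc k \<in> knowing J \<rightarrow>\<^sub>M S"
  "Upload k i \<in> J \<Longrightarrow> up k i \<in> knowing J \<rightarrow>\<^sub>M S"
  "Coin k \<in> J \<Longrightarrow> coin k \<in> knowing J \<rightarrow>\<^sub>M count_space UNIV"
proof -
  assume "Broadcast k \<in> J"
  from revealed_knowing[OF this] show "bc k \<in> knowing J \<rightarrow>\<^sub>M S"
    by (intro measurableI) (auto simp: revealed_def measurable_space[OF bc_measurable])
next
  assume "Upload k i \<in> J"
  from revealed_knowing[OF this] show "up k i \<in> knowing J \<rightarrow>\<^sub>M S"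
    by (intro measurableI) (auto simp: revealed_def measurable_space[OF up_measurable])
next
  assume "Coin k \<in> J"
  from revealed_knowing[OF this] show "coin k \<in> knowing J \<rightarrow>\<^sub>M count_space UNIV"
    by (intro measurableI) (auto simp: revealed_def)
qed

text \<open>The preimages under one random variable are closed under intersection, so independence
  of these generators passes to the sigma-algebras generated by disjoint groups of them.\<close>

lemma indep_set_knowing:
  assumes "I \<inter> J = {}"
  shows "indep_set (sets (knowing I)) (sets (knowing J))"
proof -
  have "indep_sets revealed UNIV"
    using randomness unfolding revealed_def[abs_def] algorithm_randomness_def by blast
  then have ind: "indep_sets revealed (\<Union>b\<in>UNIV. case_bool I J b)"
    by (rule indep_sets_mono_index[rotated]) simp
  have "Int_stable {f -` B \<inter> space M | B. B \<in> sets N}" for f :: "'w \<Rightarrow> 'c" and N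
  proof (rule Int_stableI)
    fix a b assume "a \<in> {f -` B \<inter> space M | B. B \<in> sets N}" "b \<in> {f -` B \<inter> space M | B. B \<in> sets N}"
    then obtain A B where "A \<in> sets N" "B \<in> sets N" "a = f -` A \<inter> space M" "b = f -` B \<inter> space M"
      by blast
    then have "A \<inter> B \<in> sets N" "a \<inter> b = f -` (A \<inter> B) \<inter> space M" by auto
    then show "a \<inter> b \<in> {f -` B \<inter> space M | B. B \<in> sets N}" by blast
  qed
  from this[of _ S] this[of _ "count_space UNIV"] have "Int_stable (revealed j)" for j
    by (cases j) (simp_all add: revealed_def)
  then have "indep_sets (\<lambda>b. sigma_sets (space M) (\<Union>i\<in>case_bool I J b. revealed i)) UNIV"
    using assms by (intro indep_sets_collect_sigma[OF ind])
      (auto simp: disjoint_family_on_def split: bool.splits)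
  then show ?thesis
    unfolding indep_set_def sets_knowing
    by (rule indep_sets_mono_sets) (auto split: bool.split)
qed

text \<open>Independence makes the two measures agree on rectangles. The product form is what allows
  integrating over the seed first, with the argument frozen.\<close>

lemma distr_Pair_knowing:
  assumes X: "X \<in> knowing I \<rightarrow>\<^sub>M N" and V: "V \<in> knowing J \<rightarrow>\<^sub>M N'" and IJ: "I \<inter> J = {}"
  shows "distr M (N \<Otimes>\<^sub>M N') (\<lambda>e. (X e, V e)) = distr M N X \<Otimes>\<^sub>M distr M N' V"
proof -
  note [measurable] = knowing_measurable[OF X] knowing_measurable[OF V]
  interpret X: prob_space "distr M N X" by (rule prob_space_distr) measurable
  interpret V: prob_space "distr M N' V" by (rule prob_space_distr) measurable
  show ?thesis
  proof (rule pair_measure_eqI[symmetric])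
    fix A B assume "A \<in> sets (distr M N X)" "B \<in> sets (distr M N' V)"
    then have [measurable]: "A \<in> sets N" "B \<in> sets N'" by auto
    have "(\<lambda>e. (X e, V e)) -` (A \<times> B) \<inter> space M = (X -` A \<inter> space M) \<inter> (V -` B \<inter> space M)"
      by auto
    moreover have "prob ((X -` A \<inter> space M) \<inter> (V -` B \<inter> space M))
        = prob (X -` A \<inter> space M) * prob (V -` B \<inter> space M)"
      using measurable_sets[OF X, of A] measurable_sets[OF V, of B]
      by (intro indep_setD[OF indep_set_knowing[OF IJ]]) auto
    ultimately show "emeasure (distr M N X) A * emeasure (distr M N' V) B
        = emeasure (distr M (N \<Otimes>\<^sub>M N') (\<lambda>e. (X e, V e))) (A \<times> B)"
      by (simp add: emeasure_distr emeasure_eq_measure ennreal_mult)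
  qed (auto intro: X.sigma_finite_measure_axioms V.sigma_finite_measure_axioms)
qed

text \<open>The axioms of a compressor concern fixed arguments; Fubini on the product law extends
  them to a random argument independent of the seed. Testing against every \<open>T\<close> known
  from \<open>J\<close> stands in for a conditional expectation.\<close>

lemma
  assumes X: "X \<in> knowing I \<rightarrow>\<^sub>M S" "distr M S X = S" and IJ: "I \<inter> J = {}"
    and V: "V \<in> borel_measurable (knowing J)" "square_integrable M V"
  shows square_integrable_compress: "square_integrable M (\<lambda>e. Q (X e) (V e))"
    and compress_variance: "(\<integral>e. (norm (Q (X e) (V e)))\<^sup>2 \<partial>M) \<le> om * (\<integral>e. (norm (V e))\<^sup>2 \<partial>M)"
    and compress_unbiased: "\<lbrakk>T \<in> borel_measurable (knowing J); square_integrable M T\<rbrakk> \<Longrightarrow>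
       (\<integral>e. T e \<bullet> Q (X e) (V e) \<partial>M) = (\<integral>e. T e \<bullet> V e \<partial>M)"
proof -
  note X_M = knowing_measurable[OF X(1)]
  note [measurable] = X_M knowing_measurable[OF V(1)]
  have meas: "(\<lambda>e. Q (X e) (V e)) \<in> borel_measurable M"
    using measurable_compose[OF measurable_Pair[OF X_M knowing_measurable[OF V(1)]] Q_measurable]
    by simp
  let ?D = "distr M borel V"
  interpret D: prob_space ?D by (rule prob_space_distr) measurable
  interpret SD: pair_prob_space S ?D ..
  have pair: "distr M (S \<Otimes>\<^sub>M borel) (\<lambda>e. (X e, V e)) = S \<Otimes>\<^sub>M ?D"
    using distr_Pair_knowing[OF X(1) V(1) IJ] X(2) by simp
  \<comment> \<open>For nonnegative integrands the order of integration can be exchanged without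
    prior integrability, so this bound comes first and supplies the square integrability used in the
    signed case below.\<close>
  have nn: "(\<integral>\<^sup>+e. ennreal ((norm (Q (X e) (V e)))\<^sup>2) \<partial>M) \<le> ennreal (om * (\<integral>e. (norm (V e))\<^sup>2 \<partial>M))"
  proof -
    have [measurable]: "(\<lambda>z. ennreal ((norm (Q (fst z) (snd z)))\<^sup>2)) \<in> borel_measurable (S \<Otimes>\<^sub>M borel)"
      using Q_measurable by (simp add: case_prod_beta')
    have "(\<integral>\<^sup>+e. ennreal ((norm (Q (X e) (V e)))\<^sup>2) \<partial>M)
        = (\<integral>\<^sup>+z. ennreal ((norm (Q (fst z) (snd z)))\<^sup>2) \<partial>(S \<Otimes>\<^sub>M ?D))"
      unfolding pair[symmetric] by (subst nn_integral_distr) auto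
    also have "\<dots> = (\<integral>\<^sup>+v. (\<integral>\<^sup>+q. ennreal ((norm (Q q v))\<^sup>2) \<partial>S) \<partial>?D)"
    proof -
      have "(\<lambda>z. ennreal ((norm (Q (fst z) (snd z)))\<^sup>2)) \<in> borel_measurable (S \<Otimes>\<^sub>M ?D)"
        by (subst measurable_cong_sets[OF sets_pair_measure_cong[OF refl sets_distr] refl]) measurable
      from SD.nn_integral_snd[OF this] show ?thesis by simp
    qed
    also have "\<dots> \<le> (\<integral>\<^sup>+v. ennreal (om * (norm v)\<^sup>2) \<partial>?D)"
    proof (rule nn_integral_mono)
      fix v
      have "(\<integral>\<^sup>+q. ennreal ((norm (Q q v))\<^sup>2) \<partial>S) = ennreal (\<integral>q. (norm (Q q v))\<^sup>2 \<partial>S)"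
        using compressor by (intro nn_integral_eq_integral) (auto simp: unbiased_compressor_def)
      then show "(\<integral>\<^sup>+q. ennreal ((norm (Q q v))\<^sup>2) \<partial>S) \<le> ennreal (om * (norm v)\<^sup>2)"
        using compressor by (simp add: unbiased_compressor_def ennreal_leI)
    qed
    also have "\<dots> = (\<integral>\<^sup>+e. ennreal (om * (norm (V e))\<^sup>2) \<partial>M)"
      by (subst nn_integral_distr) auto
    also have "\<dots> = ennreal (\<integral>e. om * (norm (V e))\<^sup>2 \<partial>M)"
      using square_integrable_norm[OF V(2)] om_ge_1 by (intro nn_integral_eq_integral) auto
    finally show ?thesis by simp
  qed
  show sq: "square_integrable M (\<lambda>e. Q (X e) (V e))"
    unfolding square_integrable_def
  proof
    show "integrable M (\<lambda>e. (norm (Q (X e) (V e)))\<^sup>2)"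
      using meas nn by (intro integrableI_nonneg) (auto simp: order_le_less_trans)
  qed (rule meas)
  show "(\<integral>e. (norm (Q (X e) (V e)))\<^sup>2 \<partial>M) \<le> om * (\<integral>e. (norm (V e))\<^sup>2 \<partial>M)"
  proof -
    have "ennreal (\<integral>e. (norm (Q (X e) (V e)))\<^sup>2 \<partial>M) \<le> ennreal (om * (\<integral>e. (norm (V e))\<^sup>2 \<partial>M))"
      using nn by (subst nn_integral_eq_integral[symmetric, OF square_integrable_norm[OF sq]]) auto
    then show ?thesis using om_ge_1 by (subst (asm) ennreal_le_iff) auto
  qed
  assume T: "T \<in> borel_measurable (knowing J)" "square_integrable M T"
  note [measurable] = knowing_measurable[OF T(1)]
  \<comment> \<open>Argument and test vector form one random variable known from \<open>J\<close>,
    so both are frozen while the seed is integrated out.\<close>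
  let ?VT = "\<lambda>e. (V e, T e)" and ?B = "borel \<Otimes>\<^sub>M borel :: ((real^'s) \<times> (real^'s)) measure"
  let ?D2 = "distr M ?B ?VT"
  interpret D2: prob_space ?D2 by (rule prob_space_distr) measurable
  interpret SD2: pair_prob_space S ?D2 ..
  have pair2: "distr M (S \<Otimes>\<^sub>M ?B) (\<lambda>e. (X e, ?VT e)) = S \<Otimes>\<^sub>M ?D2"
    using distr_Pair_knowing[OF X(1) measurable_Pair[OF V(1) T(1)] IJ] X(2) by simp
  let ?f = "\<lambda>(q, v, t). t \<bullet> Q q v"
  have f [measurable]: "?f \<in> borel_measurable (S \<Otimes>\<^sub>M ?B)"
  proof -
    have "(\<lambda>(q, v, t). Q q v) \<in> borel_measurable (S \<Otimes>\<^sub>M ?B)"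
      using measurable_compose[OF _ Q_measurable, of "\<lambda>(q, v, t). (q, v)" "S \<Otimes>\<^sub>M ?B"]
      by (simp add: case_prod_beta')
    then show ?thesis by (simp add: case_prod_beta')
  qed
  have int: "integrable (S \<Otimes>\<^sub>M ?D2) ?f"
    unfolding pair2[symmetric] using square_integrable_inner[OF T(2) sq]
    by (subst integrable_distr_eq) auto
  have "(\<integral>e. T e \<bullet> Q (X e) (V e) \<partial>M) = (\<integral>z. ?f z \<partial>(S \<Otimes>\<^sub>M ?D2))"
    unfolding pair2[symmetric] by (subst integral_distr) auto
  also have "\<dots> = (\<integral>vt. (\<integral>q. ?f (q, vt) \<partial>S) \<partial>?D2)"
    using int by (subst SD2.integral_snd) (auto simp: case_prod_beta')
  also have "\<dots> = (\<integral>vt. snd vt \<bullet> fst vt \<partial>?D2)"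
    using compressor by (intro Bochner_Integration.integral_cong)
      (auto simp: unbiased_compressor_def)
  also have "\<dots> = (\<integral>e. T e \<bullet> V e \<partial>M)" by (subst integral_distr) auto
  finally show "(\<integral>e. T e \<bullet> Q (X e) (V e) \<partial>M) = (\<integral>e. T e \<bullet> V e \<partial>M)" .
qed

text \<open>Independence of the coin from \<open>U\<close> factorises the expectation. The function
  \<open>f\<close> is arbitrary so that the centred coin and its square are both instances.\<close>

lemma
  fixes f :: "bool \<Rightarrow> real"
  assumes J: "Coin k \<notin> J" and U: "U \<in> borel_measurable (knowing J)" "integrable M U"
  shows integrable_coin: "integrable M (\<lambda>e. f (coin k e) * U e)"
    and expectation_coin: "(\<integral>e. f (coin k e) * U e \<partial>M) = (p * f True + (1 - p) * f False) * (\<integral>e. U e \<partial>M)"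
proof -
  have f_meas: "(\<lambda>e. f (coin k e)) \<in> borel_measurable (knowing {Coin k})"
    using source_knowing(3)[of k "{Coin k}"] by (auto intro: measurable_compose[where g = f])
  have sub: "sigma_sets (space M) {V -` B \<inter> space M | B. B \<in> sets borel} \<subseteq> sets (knowing I)"
    if "V \<in> borel_measurable (knowing I)" for V :: "'w \<Rightarrow> real" and I
  proof -
    have "{V -` B \<inter> space M | B. B \<in> sets borel} \<subseteq> sets (knowing I)"
      using measurable_sets[OF that] unfolding space_knowing by blast
    from sets.sigma_sets_subset[OF this] show ?thesis by simp
  qed
  have ind: "indep_var borel (\<lambda>e. f (coin k e)) borel U"
    unfolding indep_var_eq
  proof (intro conjI)
    have "indep_set (sets (knowing {Coin k})) (sets (knowing J))"
      using J by (intro indep_set_knowing) auto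
    then show "indep_set
        (sigma_sets (space M) {(\<lambda>e. f (coin k e)) -` B \<inter> space M | B. B \<in> sets borel})
        (sigma_sets (space M) {U -` B \<inter> space M | B. B \<in> sets borel})"
      unfolding indep_set_def using sub[OF f_meas] sub[OF U(1)]
      by (elim indep_sets_mono_sets) (auto split: bool.split)
  qed (use knowing_measurable[OF f_meas] knowing_measurable[OF U(1)] in auto)
  have eq: "f (coin k e) = f False + (f True - f False) * indicator {e \<in> space M. coin k e} e"
    if "e \<in> space M" for e using that by (cases "coin k e") auto
  have ind_int: "integrable M (indicat_real {e \<in> space M. coin k e})"
    by (intro integrable_real_indicator) (auto simp: emeasure_eq_measure)
  have int: "integrable M (\<lambda>e. f False + (f True - f False) * indicator {e \<in> space M. coin k e} e)"
    using ind_int by auto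
  have f_int: "integrable M (\<lambda>e. f (coin k e))"
    using int eq by (subst Bochner_Integration.integrable_cong[OF refl]) auto
  have "(\<integral>e. f (coin k e) \<partial>M) = (\<integral>e. f False + (f True - f False) * indicator {e \<in> space M. coin k e} e \<partial>M)"
    using eq by (intro Bochner_Integration.integral_cong) auto
  also have "\<dots> = f False + (f True - f False) * p"
    using ind_int by (simp add: prob_coin prob_space)
  also have "\<dots> = p * f True + (1 - p) * f False" by (simp add: algebra_simps)
  finally show "(\<integral>e. f (coin k e) * U e \<partial>M) = (p * f True + (1 - p) * f False) * (\<integral>e. U e \<partial>M)"
    using indep_var_lebesgue_integral[OF ind f_int U(2)] by simp
  show "integrable M (\<lambda>e. f (coin k e) * U e)" by (rule indep_var_integrable[OF ind f_int U(2)])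
qed

end

section \<open>The iteration\<close>

text \<open>An exact identity: both points start from the same convex combination, and x' - xh =
  -\<gamma> (g - gh). No estimate is made yet, so both negative terms stay available. With p = 0 it
  covers the update of z, which has no momentum.\<close>

lemma extragradient_step:
  fixes x w X g gh :: "'a::real_inner"
  assumes "x' = (1 - p) *\<^sub>R x + p *\<^sub>R w - \<gamma> *\<^sub>R g"
    and "xh = (1 - p) *\<^sub>R x + p *\<^sub>R w - \<gamma> *\<^sub>R gh"
  shows "2 * \<gamma> * (g \<bullet> (xh - X)) = (1 - p) * (norm (x - X))\<^sup>2 + p * (norm (w - X))\<^sup>2 - (norm (x' - X))\<^sup>2
    - (1 - p) * (norm (xh - x))\<^sup>2 - p * (norm (xh - w))\<^sup>2 + \<gamma>\<^sup>2 * (norm (g - gh))\<^sup>2"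
  unfolding assms power2_norm_eq_inner
  by (simp add: inner_simps inner_commute power2_eq_square algebra_simps)

text \<open>The mean squared distance of a two-point distribution from any point is at least its
  variance, here p (1 - p) |x - w|^2. This is how the variance of the coin gets absorbed.\<close>

lemma anchor_distance:
  fixes x w xh :: "'a::real_inner"
  shows "p * (1 - p) * (norm (x - w))\<^sup>2 \<le> (1 - p) * (norm (xh - x))\<^sup>2 + p * (norm (xh - w))\<^sup>2"
proof -
  have "(1 - p) * (norm (xh - x))\<^sup>2 + p * (norm (xh - w))\<^sup>2
      = (norm (xh - ((1 - p) *\<^sub>R x + p *\<^sub>R w)))\<^sup>2 + p * (1 - p) * (norm (x - w))\<^sup>2"
    unfolding power2_norm_eq_inner by (simp add: inner_simps inner_commute algebra_simps)
  then show ?thesis by simp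
qed

text \<open>The plain identity produces p |w - X|^2 - p |x - X|^2, whereas the potential needs |w -
  X|^2 - |w' - X|^2. The two differ by the centred coin times |x - X|^2 - |w - X|^2. There |X|^2
  cancels, and expanding around x0 leaves a part linear in X - x0 and an offset free of X.\<close>

lemma noisy_extragradient_step:
  fixes x w X x0 g n gh :: "'a::real_inner"
  assumes x': "x' = (1 - p) *\<^sub>R x + p *\<^sub>R w - \<gamma> *\<^sub>R (g + n)"
    and xh: "xh = (1 - p) *\<^sub>R x + p *\<^sub>R w - \<gamma> *\<^sub>R gh"
    and w': "w' = (if c then x else w)"
  shows "2 * \<gamma> * (g \<bullet> (xh - X)) =
      ((norm (x - X))\<^sup>2 + (norm (w - X))\<^sup>2) - ((norm (x' - X))\<^sup>2 + (norm (w' - X))\<^sup>2)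
      + ((2 * \<gamma>) *\<^sub>R n - (2 * (of_bool c - p)) *\<^sub>R (x - w)) \<bullet> (X - x0)
      + ((of_bool c - p) * ((norm (x - x0))\<^sup>2 - (norm (w - x0))\<^sup>2) - 2 * \<gamma> * (n \<bullet> (xh - x0)))
      + (\<gamma>\<^sup>2 * (norm (g + n - gh))\<^sup>2 - (1 - p) * (norm (xh - x))\<^sup>2 - p * (norm (xh - w))\<^sup>2)"
proof -
  have step: "2 * \<gamma> * ((g + n) \<bullet> (xh - X)) = (1 - p) * (norm (x - X))\<^sup>2 + p * (norm (w - X))\<^sup>2
      - (norm (x' - X))\<^sup>2 - (1 - p) * (norm (xh - x))\<^sup>2 - p * (norm (xh - w))\<^sup>2
      + \<gamma>\<^sup>2 * (norm (g + n - gh))\<^sup>2"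
    by (rule extragradient_step[OF x' xh])
  have dist: "(norm (x - X))\<^sup>2 - (norm (w - X))\<^sup>2
      = (norm (x - x0))\<^sup>2 - (norm (w - x0))\<^sup>2 - 2 * ((x - w) \<bullet> (X - x0))"
    unfolding power2_norm_eq_inner by (simp add: inner_simps inner_commute algebra_simps)
  define C :: real where "C = of_bool c"
  have coin: "(norm (w - X))\<^sup>2 - (norm (w' - X))\<^sup>2 + (C - p) * ((norm (x - X))\<^sup>2 - (norm (w - X))\<^sup>2)
      = p * (norm (w - X))\<^sup>2 - p * (norm (x - X))\<^sup>2"
    unfolding w' C_def by (cases c) (simp_all add: algebra_simps)
  have dist': "(C - p) * ((norm (x - X))\<^sup>2 - (norm (w - X))\<^sup>2)
      = (C - p) * ((norm (x - x0))\<^sup>2 - (norm (w - x0))\<^sup>2) - 2 * (C - p) * ((x - w) \<bullet> (X - x0))"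
    unfolding dist by (simp add: algebra_simps)
  have split: "(1 - p) * (norm (x - X))\<^sup>2 = (norm (x - X))\<^sup>2 - p * (norm (x - X))\<^sup>2"
    by (simp only: left_diff_distrib mult_1)
  have noise: "2 * \<gamma> * (g \<bullet> (xh - X))
      = 2 * \<gamma> * ((g + n) \<bullet> (xh - X)) - 2 * \<gamma> * (n \<bullet> (xh - x0)) + 2 * \<gamma> * (n \<bullet> (X - x0))"
    by (simp add: inner_simps algebra_simps)
  have "((2 * \<gamma>) *\<^sub>R n - (2 * (C - p)) *\<^sub>R (x - w)) \<bullet> (X - x0)
      = 2 * \<gamma> * (n \<bullet> (X - x0)) - 2 * (C - p) * ((x - w) \<bullet> (X - x0))"
    by (simp only: inner_diff_left inner_scaleR_left)
  with step coin dist' split noise show ?thesis unfolding C_def[symmetric] by linarith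
qed

text \<open>The weights 1 + 3 and 1 + 1/3 favour the second summand, which receives the smoothness
  errors: 4/3 times the factor 1/16 from the stepsize is 1/12, less than 1 - p >= 1/10. Equal
  weights would give 1/8, which is too much.\<close>

lemma young_sq: "(norm (a + b))\<^sup>2 \<le> 4 * (norm a)\<^sup>2 + 4 / 3 * (norm b)\<^sup>2" for a b :: "'a::real_inner"
proof -
  have "0 \<le> (norm (3 *\<^sub>R a - b))\<^sup>2" by simp
  then show ?thesis unfolding power2_norm_eq_inner by (simp add: inner_simps inner_commute)
qed

text \<open>The weights satisfy 4 * (1/100) * 25 = 1. The small one keeps the drift variances well
  below the negative terms; the large one only enters the final constant.\<close>

lemma inner_le_weighted: "a \<bullet> b \<le> 1 / 100 * (norm a)\<^sup>2 + 25 * (norm b)\<^sup>2" for a b :: "'e::real_inner"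
proof -
  have "0 \<le> (norm ((1 / 10) *\<^sub>R a - 5 *\<^sub>R b))\<^sup>2" by simp
  then show ?thesis
    unfolding power2_norm_eq_inner by (simp add: inner_simps inner_commute algebra_simps)
qed

section \<open>Adapted square integrable random vectors\<close>

context compression_noise
begin

definition adapted :: "'n source set \<Rightarrow> ('w \<Rightarrow> 'e::euclidean_space) \<Rightarrow> bool" where
  "adapted J V \<longleftrightarrow> V \<in> borel_measurable (knowing J) \<and> square_integrable M V"

lemma adapted_square_integrable: "adapted J V \<Longrightarrow> square_integrable M V"
  by (simp add: adapted_def)

lemma adapted_mono: "adapted J V \<Longrightarrow> J \<subseteq> J' \<Longrightarrow> adapted J' V"
  by (auto simp: adapted_def intro: knowing_mono)

lemma adapted_const: "adapted J (\<lambda>e. c)"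
  by (simp add: adapted_def square_integrable_const)

lemma adapted_add: "adapted J V \<Longrightarrow> adapted J W \<Longrightarrow> adapted J (\<lambda>e. V e + W e)"
  by (auto simp: adapted_def square_integrable_add)

lemma adapted_diff: "adapted J V \<Longrightarrow> adapted J W \<Longrightarrow> adapted J (\<lambda>e. V e - W e)"
  by (auto simp: adapted_def square_integrable_diff)

lemma adapted_scaleR: "adapted J V \<Longrightarrow> adapted J (\<lambda>e. c *\<^sub>R V e)"
  by (auto simp: adapted_def square_integrable_scaleR)

lemma adapted_sum: "(\<And>i. i \<in> I \<Longrightarrow> adapted J (V i)) \<Longrightarrow> adapted J (\<lambda>e. \<Sum>i\<in>I. V i e)"
  unfolding adapted_def by (intro conjI borel_measurable_sum square_integrable_sum) auto

lemma adapted_lipschitz: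
  assumes V: "adapted J V" and lip: "\<And>u v. norm (g u - g v) \<le> L * norm (u - v)"
  shows "adapted J (\<lambda>e. g (V e))"
proof -
  have "\<bar>L\<bar>-lipschitz_on UNIV g"
  proof (rule lipschitz_onI)
    show "dist (g u) (g v) \<le> \<bar>L\<bar> * dist u v" for u v
      using lip[of u v] mult_right_mono[OF abs_ge_self[of L] norm_ge_zero[of "u - v"]]
      unfolding dist_norm by linarith
  qed simp
  then have cont: "continuous_on UNIV g" by (rule lipschitz_on_continuous_on)
  then have "(\<lambda>e. g (V e)) \<in> borel_measurable (knowing J)"
    using V by (auto simp: adapted_def intro: measurable_compose borel_measurable_continuous_onI)
  with V square_integrable_lipschitz[OF _ cont lip, of V] show ?thesis by (simp add: adapted_def)
qed

lemma adapted_linear: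
  assumes V: "adapted J V" and lin: "linear g"
  shows "adapted J (\<lambda>e. g (V e))"
proof (rule adapted_lipschitz[OF V])
  have bl: "bounded_linear g" using lin by (simp add: linear_conv_bounded_linear)
  show "norm (g u - g v) \<le> onorm g * norm (u - v)" for u v
    using onorm[OF bl, of "u - v"] by (simp add: linear_diff[OF lin])
qed

lemma adapted_coin_if:
  assumes "adapted J V" "adapted J W" "Coin k \<in> J"
  shows "adapted J (\<lambda>e. if coin k e then V e else W e)"
proof -
  have c: "coin k \<in> knowing J \<rightarrow>\<^sub>M count_space UNIV" by (rule source_knowing(3)[OF assms(3)])
  have "Measurable.pred (knowing J) (coin k)" by (rule c)
  then have meas: "(\<lambda>e. if coin k e then V e else W e) \<in> borel_measurable (knowing J)"
    using assms by (intro measurable_If) (auto simp: adapted_def pred_def)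
  have "square_integrable M (\<lambda>e. if coin k e then V e else W e)"
  proof (rule square_integrable_bound)
    show "integrable M (\<lambda>e. (norm (V e))\<^sup>2 + (norm (W e))\<^sup>2)"
      using assms by (auto simp: adapted_def square_integrable_def)
    show "(\<lambda>e. if coin k e then V e else W e) \<in> borel_measurable M"
      by (rule knowing_measurable[OF meas])
  qed auto
  with meas show ?thesis by (simp add: adapted_def)
qed

lemma adapted_coin_scaleR:
  assumes "adapted J V" "Coin k \<in> J"
  shows "adapted J (\<lambda>e. (a * (of_bool (coin k e) - b)) *\<^sub>R V e)"
proof -
  have "(\<lambda>e. (a * (of_bool (coin k e) - b)) *\<^sub>R V e)
      = (\<lambda>e. if coin k e then (a * (1 - b)) *\<^sub>R V e else (- a * b) *\<^sub>R V e)"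
    by auto
  then show ?thesis using assms by (simp only: adapted_coin_if adapted_scaleR)
qed

text \<open>\<open>V\<close> itself is known from \<open>J\<close> and hence orthogonal to the
  compression error, so Pythagoras gives the factor om - 1. Its sharpness matters for the sum of the
  uploads: lam for the mean and (om - 1) lam for the noise add up to om lam.\<close>

lemma
  assumes X: "X \<in> knowing I \<rightarrow>\<^sub>M S" "distr M S X = S" and IJ: "I \<inter> J = {}" and V: "adapted J V"
  shows adapted_compress: "adapted (I \<union> J) (\<lambda>e. Q (X e) (V e))"
    and compress_sq: "(\<integral>e. (norm (Q (X e) (V e)))\<^sup>2 \<partial>M) \<le> om * (\<integral>e. (norm (V e))\<^sup>2 \<partial>M)"
    and compress_noise_sq:
      "(\<integral>e. (norm (Q (X e) (V e) - V e))\<^sup>2 \<partial>M) \<le> (om - 1) * (\<integral>e. (norm (V e))\<^sup>2 \<partial>M)"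
    and compress_noise_orth: "adapted J T \<Longrightarrow> (\<integral>e. T e \<bullet> (Q (X e) (V e) - V e) \<partial>M) = 0"
proof -
  note V' = V[unfolded adapted_def, THEN conjunct1] V[unfolded adapted_def, THEN conjunct2]
  note sq = square_integrable_compress[OF X IJ V']
  have "(\<lambda>e. (X e, V e)) \<in> knowing (I \<union> J) \<rightarrow>\<^sub>M S \<Otimes>\<^sub>M borel"
    by (intro measurable_Pair knowing_mono[OF _ X(1)] knowing_mono[OF _ V'(1)]) auto
  from measurable_compose[OF this Q_measurable]
  show "adapted (I \<union> J) (\<lambda>e. Q (X e) (V e))"
    using sq by (simp add: adapted_def)
  show sq_le: "(\<integral>e. (norm (Q (X e) (V e)))\<^sup>2 \<partial>M) \<le> om * (\<integral>e. (norm (V e))\<^sup>2 \<partial>M)"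
    by (rule compress_variance[OF X IJ V'])
  have orth: "(\<integral>e. T e \<bullet> (Q (X e) (V e) - V e) \<partial>M) = 0" if "adapted J T" for T
    using that compress_unbiased[OF X IJ V', of T]
      square_integrable_inner[OF _ sq, of T] square_integrable_inner[OF _ V'(2), of T]
    by (simp add: adapted_def inner_diff_right)
  then show "adapted J T \<Longrightarrow> (\<integral>e. T e \<bullet> (Q (X e) (V e) - V e) \<partial>M) = 0" .
  have "(norm (Q (X e) (V e) - V e))\<^sup>2
      = (norm (Q (X e) (V e)))\<^sup>2 - (norm (V e))\<^sup>2 - 2 * (V e \<bullet> (Q (X e) (V e) - V e))" for e
    unfolding power2_norm_eq_inner by (simp add: inner_simps inner_commute)
  then have "(\<integral>e. (norm (Q (X e) (V e) - V e))\<^sup>2 \<partial>M)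
      = (\<integral>e. (norm (Q (X e) (V e)))\<^sup>2 \<partial>M) - (\<integral>e. (norm (V e))\<^sup>2 \<partial>M)"
    using orth[OF V] square_integrable_norm[OF sq] square_integrable_norm[OF V'(2)]
      square_integrable_inner[OF V'(2) square_integrable_diff[OF sq V'(2)]]
    by simp
  with sq_le show "(\<integral>e. (norm (Q (X e) (V e) - V e))\<^sup>2 \<partial>M) \<le> (om - 1) * (\<integral>e. (norm (V e))\<^sup>2 \<partial>M)"
    by (simp add: algebra_simps)
qed

fun time :: "'n source \<Rightarrow> nat" where
  "time (Broadcast k) = k"
| "time (Upload k i) = k"
| "time (Coin k) = k"

text \<open>The inequality is strict: the state entering iteration \<open>k\<close> is determined by
  \<open>past k\<close>, while the seeds and the coin of iteration \<open>k\<close> are independent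
  of it.\<close>

definition past :: "nat \<Rightarrow> 'n source set" where
  "past k = {src. time src < k}"

lemma past_mono: "k \<le> k' \<Longrightarrow> past k \<subseteq> past k'"
  by (auto simp: past_def)

end

text \<open>The stochastic argument sees only linear maps, Lipschitz maps and the recursion. The
  devices survive as the maps \<open>A i\<close> since each sends its own message. Hence two bounds:
  on the norm of the sum, for the mean of the messages, and on the sum of the squared norms, for
  their variances.\<close>

locale compressed_extragradient = compression_noise M S Q om p bc up coin
  for M :: "'w measure" and S :: "'q measure" and Q :: "'q \<Rightarrow> real ^ 's::finite \<Rightarrow> real ^ 's"
    and om p :: real and bc :: "nat \<Rightarrow> 'w \<Rightarrow> 'q" and up :: "nat \<Rightarrow> 'n::finite \<Rightarrow> 'w \<Rightarrow> 'q"
    and coin :: "nat \<Rightarrow> 'w \<Rightarrow> bool" +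
  fixes A :: "'n \<Rightarrow> 'a::euclidean_space \<Rightarrow> real ^ 's" and At :: "real ^ 's \<Rightarrow> 'a"
    and gr :: "'a \<Rightarrow> 'a" and gl :: "real ^ 's \<Rightarrow> real ^ 's" and Lr Ll lam \<gamma> :: real
    and x w xh :: "nat \<Rightarrow> 'w \<Rightarrow> 'a" and z y u zh yh :: "nat \<Rightarrow> 'w \<Rightarrow> real ^ 's"
    and x0 w0 :: 'a and z0 y0 u0 :: "real ^ 's"
  assumes A_linear: "linear (A i)" and At_linear: "linear At"
    and At_adjoint: "At v \<bullet> a = v \<bullet> (\<Sum>i\<in>UNIV. A i a)"
    and At_bound: "(norm (At v))\<^sup>2 \<le> lam * (norm v)\<^sup>2"
    and A_bound: "(norm (\<Sum>i\<in>UNIV. A i a))\<^sup>2 \<le> lam * (norm a)\<^sup>2"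
    and A_blocks_bound: "(\<Sum>i\<in>UNIV. (norm (A i a))\<^sup>2) \<le> lam * (norm a)\<^sup>2"
    and lam: "0 \<le> lam"
    and gr_lipschitz: "norm (gr a - gr b) \<le> Lr * norm (a - b)"
    and gl_lipschitz: "norm (gl v - gl v') \<le> Ll * norm (v - v')"
    and p: "0 < p" "p \<le> 9 / 10"
    and \<gamma>: "0 < \<gamma>" "\<gamma> \<le> 1 / 4" "\<gamma> * Lr \<le> 1 / 4" "\<gamma> * Ll \<le> 1 / 4" "\<gamma>\<^sup>2 * (om * lam) \<le> p / 16"
    and init: "x 0 e = x0" "z 0 e = z0" "y 0 e = y0" "w 0 e = w0" "u 0 e = u0"
    and xh: "xh k e = (1 - p) *\<^sub>R x k e + p *\<^sub>R w k e - \<gamma> *\<^sub>R (At (u k e) + gr (x k e))"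
    and zh: "zh k e = z k e - \<gamma> *\<^sub>R (gl (z k e) - y k e)"
    and yh: "yh k e = (1 - p) *\<^sub>R y k e + p *\<^sub>R u k e + \<gamma> *\<^sub>R ((\<Sum>i\<in>UNIV. A i (w k e)) - z k e)"
    and x_Suc: "x (Suc k) e = (1 - p) *\<^sub>R x k e + p *\<^sub>R w k e
        - \<gamma> *\<^sub>R (At (Q (bc k e) (yh k e - u k e) + u k e) + gr (xh k e))"
    and z_Suc: "z (Suc k) e = z k e - \<gamma> *\<^sub>R (gl (zh k e) - yh k e)"
    and y_Suc: "y (Suc k) e = (1 - p) *\<^sub>R y k e + p *\<^sub>R u k e
        + \<gamma> *\<^sub>R ((\<Sum>i\<in>UNIV. Q (up k i e) (A i (xh k e - w k e)) + A i (w k e)) - zh k e)"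
    and w_Suc: "w (Suc k) e = (if coin k e then x k e else w k e)"
    and u_Suc: "u (Suc k) e = (if coin k e then y k e else u k e)"
begin

section \<open>Measurability of the iterates and moments of their compression noise\<close>

lemma At_diff: "At (a - b) = At a - At b" and At_add: "At (a + b) = At a + At b"
  using At_linear by (auto simp: linear_diff linear_add)

lemma A_diff: "A i (a - b) = A i a - A i b"
  using A_linear by (auto simp: linear_diff)

lemma
  assumes "adapted J (x k)" "adapted J (z k)" "adapted J (y k)" "adapted J (w k)" "adapted J (u k)"
  shows adapted_xh: "adapted J (xh k)" and adapted_zh: "adapted J (zh k)"
    and adapted_yh: "adapted J (yh k)"
  unfolding xh[abs_def] zh[abs_def] yh[abs_def]
  by (intro adapted_add adapted_diff adapted_scaleR adapted_sum adapted_linear[OF _ A_linear]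
      adapted_linear[OF _ At_linear] adapted_lipschitz[OF _ gr_lipschitz]
      adapted_lipschitz[OF _ gl_lipschitz] assms)+

lemma broadcast: "bc k \<in> knowing {Broadcast k} \<rightarrow>\<^sub>M S" "{Broadcast k} \<inter> past k = {}"
  by (auto simp: past_def intro: source_knowing)

lemma upload: "up k i \<in> knowing {Upload k i} \<rightarrow>\<^sub>M S" "{Upload k i} \<inter> past k = {}"
  by (auto simp: past_def intro: source_knowing)

lemma adapted_state:
  "adapted (past k) (x k) \<and> adapted (past k) (z k) \<and> adapted (past k) (y k) \<and>
   adapted (past k) (w k) \<and> adapted (past k) (u k)"
proof (induction k)
  case 0
  have "x 0 = (\<lambda>e. x0)" "z 0 = (\<lambda>e. z0)" "y 0 = (\<lambda>e. y0)" "w 0 = (\<lambda>e. w0)" "u 0 = (\<lambda>e. u0)"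
    using init by auto
  then show ?case by (simp add: adapted_const)
next
  case (Suc k)
  then have half: "adapted (past k) (xh k)" "adapted (past k) (zh k)" "adapted (past k) (yh k)"
    by (auto intro: adapted_xh adapted_zh adapted_yh)
  have le: "past k \<subseteq> past (Suc k)" by (simp add: past_mono)
  have now: "{Broadcast k} \<union> past k \<subseteq> past (Suc k)" "{Upload k i} \<union> past k \<subseteq> past (Suc k)"
    "Coin k \<in> past (Suc k)" for i
    by (auto simp: past_def)
  note old = Suc half
  have st: "adapted (past (Suc k)) (x k)" "adapted (past (Suc k)) (z k)" "adapted (past (Suc k)) (y k)"
     "adapted (past (Suc k)) (w k)" "adapted (past (Suc k)) (u k)" "adapted (past (Suc k)) (xh k)"
     "adapted (past (Suc k)) (zh k)" "adapted (past (Suc k)) (yh k)"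
    using old adapted_mono[OF _ le] by blast+
  have q: "adapted (past (Suc k)) (\<lambda>e. Q (bc k e) (yh k e - u k e))"
    using old by (intro adapted_mono[OF adapted_compress[OF broadcast(1) distr_bc broadcast(2)] now(1)]
        adapted_diff) auto
  have s: "adapted (past (Suc k)) (\<lambda>e. Q (up k i e) (A i (xh k e - w k e)))" for i
    using old by (intro adapted_mono[OF adapted_compress[OF upload(1) distr_up upload(2)] now(2)]
        adapted_linear[OF _ A_linear] adapted_diff) auto
  have "x (Suc k) = (\<lambda>e. (1 - p) *\<^sub>R x k e + p *\<^sub>R w k e
        - \<gamma> *\<^sub>R (At (Q (bc k e) (yh k e - u k e) + u k e) + gr (xh k e)))"
    by (simp add: x_Suc fun_eq_iff)
  moreover have "adapted (past (Suc k)) \<dots>"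
    by (intro adapted_add adapted_diff adapted_scaleR adapted_linear[OF _ At_linear]
        adapted_lipschitz[OF _ gr_lipschitz] st q)
  moreover have "z (Suc k) = (\<lambda>e. z k e - \<gamma> *\<^sub>R (gl (zh k e) - yh k e))"
    by (simp add: z_Suc fun_eq_iff)
  moreover have "adapted (past (Suc k)) \<dots>"
    by (intro adapted_diff adapted_scaleR adapted_lipschitz[OF _ gl_lipschitz] st)
  moreover have "y (Suc k) = (\<lambda>e. (1 - p) *\<^sub>R y k e + p *\<^sub>R u k e
        + \<gamma> *\<^sub>R ((\<Sum>i\<in>UNIV. Q (up k i e) (A i (xh k e - w k e)) + A i (w k e)) - zh k e))"
    by (simp add: y_Suc fun_eq_iff)
  moreover have "adapted (past (Suc k)) \<dots>"
    by (intro adapted_add adapted_diff adapted_scaleR adapted_sum adapted_linear[OF _ A_linear] st s)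
  moreover have "w (Suc k) = (\<lambda>e. if coin k e then x k e else w k e)"
    by (simp add: w_Suc fun_eq_iff)
  moreover have "adapted (past (Suc k)) \<dots>" by (intro adapted_coin_if st now)
  moreover have "u (Suc k) = (\<lambda>e. if coin k e then y k e else u k e)"
    by (simp add: u_Suc fun_eq_iff)
  moreover have "adapted (past (Suc k)) \<dots>" by (intro adapted_coin_if st now)
  ultimately show ?case by simp
qed

lemma adapted_iterates:
  "adapted (past k) (x k)" "adapted (past k) (z k)" "adapted (past k) (y k)"
  "adapted (past k) (w k)" "adapted (past k) (u k)" "adapted (past k) (xh k)"
  "adapted (past k) (zh k)" "adapted (past k) (yh k)"
  using adapted_state[of k] by (auto intro: adapted_xh adapted_zh adapted_yh)

definition \<xi> :: "nat \<Rightarrow> 'w \<Rightarrow> real ^ 's" where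
  "\<xi> k e = Q (bc k e) (yh k e - u k e) - (yh k e - u k e)"

definition \<zeta> :: "nat \<Rightarrow> 'w \<Rightarrow> real ^ 's" where
  "\<zeta> k e = (\<Sum>i\<in>UNIV. Q (up k i e) (A i (xh k e - w k e)) - A i (xh k e - w k e))"

lemma
  shows \<xi>_orth: "adapted (past k) T \<Longrightarrow> (\<integral>e. T e \<bullet> \<xi> k e \<partial>M) = 0"
    and \<xi>_sq: "(\<integral>e. (norm (\<xi> k e))\<^sup>2 \<partial>M) \<le> om * (\<integral>e. (norm (yh k e - u k e))\<^sup>2 \<partial>M)"
    and q_sq: "(\<integral>e. (norm (Q (bc k e) (yh k e - u k e)))\<^sup>2 \<partial>M) \<le> om * (\<integral>e. (norm (yh k e - u k e))\<^sup>2 \<partial>M)"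
    and q_square_integrable: "square_integrable M (\<lambda>e. Q (bc k e) (yh k e - u k e))"
    and \<xi>_square_integrable: "square_integrable M (\<xi> k)"
    and adapted_\<xi>: "adapted ({Broadcast k} \<union> past k) (\<xi> k)"
proof -
  have V: "adapted (past k) (\<lambda>e. yh k e - u k e)" by (intro adapted_diff adapted_iterates)
  note c = adapted_compress[OF broadcast(1) distr_bc broadcast(2) V]
    compress_sq[OF broadcast(1) distr_bc broadcast(2) V]
    compress_noise_sq[OF broadcast(1) distr_bc broadcast(2) V]
    compress_noise_orth[OF broadcast(1) distr_bc broadcast(2) V]
  show "adapted (past k) T \<Longrightarrow> (\<integral>e. T e \<bullet> \<xi> k e \<partial>M) = 0"
    unfolding \<xi>_def by (rule c)
  show "(\<integral>e. (norm (Q (bc k e) (yh k e - u k e)))\<^sup>2 \<partial>M) \<le> om * (\<integral>e. (norm (yh k e - u k e))\<^sup>2 \<partial>M)"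
    by (rule c)
  have "0 \<le> (\<integral>e. (norm (yh k e - u k e))\<^sup>2 \<partial>M)" by simp
  then show "(\<integral>e. (norm (\<xi> k e))\<^sup>2 \<partial>M) \<le> om * (\<integral>e. (norm (yh k e - u k e))\<^sup>2 \<partial>M)"
    using c(3) unfolding \<xi>_def left_diff_distrib mult_1 by linarith
  show "square_integrable M (\<lambda>e. Q (bc k e) (yh k e - u k e))" by (rule adapted_square_integrable[OF c(1)])
  show a: "adapted ({Broadcast k} \<union> past k) (\<xi> k)"
    unfolding \<xi>_def[abs_def] by (intro adapted_diff[OF c(1)] adapted_mono[OF V]) auto
  show "square_integrable M (\<xi> k)" by (rule adapted_square_integrable[OF a])
qed

text \<open>The devices use independent seeds, so their errors are mutually orthogonal and the
  variances add up; the number of devices does not enter the bound.\<close>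

lemma
  shows \<zeta>_orth: "adapted (past k) T \<Longrightarrow> (\<integral>e. T e \<bullet> \<zeta> k e \<partial>M) = 0"
    and \<zeta>_sq: "(\<integral>e. (norm (\<zeta> k e))\<^sup>2 \<partial>M) \<le> om * lam * (\<integral>e. (norm (xh k e - w k e))\<^sup>2 \<partial>M)"
    and s_sq: "(\<integral>e. (norm (\<Sum>i\<in>UNIV. Q (up k i e) (A i (xh k e - w k e))))\<^sup>2 \<partial>M)
        \<le> om * lam * (\<integral>e. (norm (xh k e - w k e))\<^sup>2 \<partial>M)"
    and s_square_integrable: "square_integrable M (\<lambda>e. \<Sum>i\<in>UNIV. Q (up k i e) (A i (xh k e - w k e)))"
    and \<zeta>_square_integrable: "square_integrable M (\<zeta> k)"
    and adapted_\<zeta>: "adapted (range (Upload k) \<union> past k) (\<zeta> k)"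
proof -
  define d where "d e = xh k e - w k e" for e
  define D where "D i e = Q (up k i e) (A i (d e)) - A i (d e)" for i e
  have d: "adapted (past k) d" unfolding d_def[abs_def] by (intro adapted_diff adapted_iterates)
  have V: "adapted (past k) (\<lambda>e. A i (d e))" for i by (intro adapted_linear[OF _ A_linear] d)
  have \<zeta>_eq: "\<zeta> k = (\<lambda>e. \<Sum>i\<in>UNIV. D i e)" by (simp add: \<zeta>_def D_def d_def fun_eq_iff)
  have s: "adapted ({Upload k i} \<union> past k) (\<lambda>e. Q (up k i e) (A i (d e)))" for i
    by (rule adapted_compress[OF upload(1) distr_up upload(2) V])
  have D: "adapted ({Upload k i} \<union> past k) (D i)" for i
    unfolding D_def[abs_def] by (intro adapted_diff s adapted_mono[OF V]) auto
  note Dsq = adapted_square_integrable[OF D]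
  \<comment> \<open>\<open>J\<close> may exceed \<open>past k\<close>: then \<open>T\<close> can be
    the error of another device in the same iteration, which makes the cross terms vanish.\<close>
  have orth: "(\<integral>e. T e \<bullet> D i e \<partial>M) = 0" if "adapted J T" "past k \<subseteq> J" "Upload k i \<notin> J" for T i J
    unfolding D_def using that
    by (intro compress_noise_orth[OF upload(1) distr_up _ adapted_mono[OF V]]) auto
  have D_orth: "(\<integral>e. D i e \<bullet> D j e \<partial>M) = 0" if "i \<noteq> j" for i j
    using that by (intro orth[OF D]) (auto simp: past_def)
  show T_orth: "(\<integral>e. T e \<bullet> \<zeta> k e \<partial>M) = 0" if T: "adapted (past k) T" for T
  proof -
    have "(\<integral>e. T e \<bullet> \<zeta> k e \<partial>M) = (\<Sum>i\<in>UNIV. \<integral>e. T e \<bullet> D i e \<partial>M)"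
      unfolding \<zeta>_eq inner_sum_right
      by (intro Bochner_Integration.integral_sum square_integrable_inner Dsq adapted_square_integrable[OF T])
    also have "\<dots> = 0" by (intro sum.neutral ballI orth[OF T]) (auto simp: past_def)
    finally show ?thesis .
  qed
  show a: "adapted (range (Upload k) \<union> past k) (\<zeta> k)"
    unfolding \<zeta>_eq by (intro adapted_sum adapted_mono[OF D]) auto
  show \<zeta>_int: "square_integrable M (\<zeta> k)" by (rule adapted_square_integrable[OF a])
  have d_int: "integrable M (\<lambda>e. (norm (d e))\<^sup>2)"
    by (rule square_integrable_norm[OF adapted_square_integrable[OF d]])
  have "(\<integral>e. (norm (\<zeta> k e))\<^sup>2 \<partial>M) = (\<Sum>i\<in>UNIV. \<Sum>j\<in>UNIV. \<integral>e. D i e \<bullet> D j e \<partial>M)"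
    unfolding \<zeta>_eq power2_norm_eq_inner inner_sum_left inner_sum_right
    by (subst sum.swap) (simp add: Bochner_Integration.integral_sum square_integrable_inner Dsq)
  also have "\<dots> = (\<Sum>i\<in>UNIV. \<integral>e. (norm (D i e))\<^sup>2 \<partial>M)"
  proof (intro sum.cong refl)
    fix i
    have "(\<Sum>j\<in>UNIV. \<integral>e. D i e \<bullet> D j e \<partial>M) = (\<Sum>j\<in>UNIV. if j = i then (\<integral>e. (norm (D i e))\<^sup>2 \<partial>M) else 0)"
      using D_orth[of i] by (intro sum.cong) (auto simp: power2_norm_eq_inner)
    then show "(\<Sum>j\<in>UNIV. \<integral>e. D i e \<bullet> D j e \<partial>M) = (\<integral>e. (norm (D i e))\<^sup>2 \<partial>M)" by simp
  qed
  also have "\<dots> \<le> (\<Sum>i\<in>UNIV. (om - 1) * (\<integral>e. (norm (A i (d e)))\<^sup>2 \<partial>M))"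
    unfolding D_def by (intro sum_mono compress_noise_sq[OF upload(1) distr_up upload(2) V])
  also have "\<dots> = (om - 1) * (\<integral>e. (\<Sum>i\<in>UNIV. (norm (A i (d e)))\<^sup>2) \<partial>M)"
    unfolding sum_distrib_left[symmetric]
    by (subst Bochner_Integration.integral_sum)
      (auto intro: square_integrable_norm[OF adapted_square_integrable[OF V]])
  also have "\<dots> \<le> (om - 1) * (\<integral>e. lam * (norm (d e))\<^sup>2 \<partial>M)"
  proof (intro mult_left_mono integral_mono)
    show "integrable M (\<lambda>e. \<Sum>i\<in>UNIV. (norm (A i (d e)))\<^sup>2)"
      by (intro Bochner_Integration.integrable_sum square_integrable_norm[OF adapted_square_integrable[OF V]])
  qed (use d_int A_blocks_bound om_ge_1 in auto)
  finally have \<zeta>: "(\<integral>e. (norm (\<zeta> k e))\<^sup>2 \<partial>M) \<le> (om - 1) * lam * (\<integral>e. (norm (d e))\<^sup>2 \<partial>M)"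
    by simp
  have "0 \<le> lam * (\<integral>e. (norm (d e))\<^sup>2 \<partial>M)" using lam by simp
  with \<zeta> show "(\<integral>e. (norm (\<zeta> k e))\<^sup>2 \<partial>M) \<le> om * lam * (\<integral>e. (norm (xh k e - w k e))\<^sup>2 \<partial>M)"
    unfolding d_def by (simp add: left_diff_distrib)
  show s_int: "square_integrable M (\<lambda>e. \<Sum>i\<in>UNIV. Q (up k i e) (A i (xh k e - w k e)))"
    using s unfolding d_def by (intro square_integrable_sum) (auto simp: adapted_def)
  \<comment> \<open>The sum of the messages is the vector \<open>Ad\<close>, known beforehand, plus
    orthogonal noise, so the two second moments add up to om lam |d|^2 in expectation.\<close>
  define Ad where "Ad e = (\<Sum>i\<in>UNIV. A i (d e))" for e
  have Ad: "adapted (past k) Ad" unfolding Ad_def[abs_def] by (intro adapted_sum V)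
  note Ad_int = adapted_square_integrable[OF Ad]
  have "(\<Sum>i\<in>UNIV. Q (up k i e) (A i (xh k e - w k e))) = Ad e + \<zeta> k e" for e
    unfolding \<zeta>_def Ad_def d_def by (simp add: sum_subtractf)
  then have "(norm (\<Sum>i\<in>UNIV. Q (up k i e) (A i (xh k e - w k e))))\<^sup>2
      = (norm (Ad e))\<^sup>2 + 2 * (Ad e \<bullet> \<zeta> k e) + (norm (\<zeta> k e))\<^sup>2" for e
    by (simp add: power2_norm_eq_inner inner_simps inner_commute)
  then have "(\<integral>e. (norm (\<Sum>i\<in>UNIV. Q (up k i e) (A i (xh k e - w k e))))\<^sup>2 \<partial>M)
      = (\<integral>e. (norm (Ad e))\<^sup>2 \<partial>M) + (\<integral>e. (norm (\<zeta> k e))\<^sup>2 \<partial>M)"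
    using T_orth[OF Ad] square_integrable_norm[OF Ad_int] square_integrable_norm[OF \<zeta>_int]
      square_integrable_inner[OF Ad_int \<zeta>_int] by simp
  also have "(\<integral>e. (norm (Ad e))\<^sup>2 \<partial>M) \<le> (\<integral>e. lam * (norm (d e))\<^sup>2 \<partial>M)"
    using square_integrable_norm[OF Ad_int] d_int A_bound unfolding Ad_def
    by (intro integral_mono) auto
  finally show "(\<integral>e. (norm (\<Sum>i\<in>UNIV. Q (up k i e) (A i (xh k e - w k e))))\<^sup>2 \<partial>M)
      \<le> om * lam * (\<integral>e. (norm (xh k e - w k e))\<^sup>2 \<partial>M)"
    using \<zeta> unfolding d_def by (simp add: algebra_simps)
qed

end

section \<open>Martingale increments and the centred coin\<close>

context compression_noise
begin

text \<open>The sum of the earlier increments is known when the next one is drawn, hence orthogonal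
  to it; induction by Pythagoras.\<close>

lemma martingale_sum_sq:
  assumes D: "\<And>k. adapted (past (Suc k)) (D k)"
    and orth: "\<And>k T. adapted (past k) T \<Longrightarrow> (\<integral>e. T e \<bullet> D k e \<partial>M) = 0"
  shows "(\<integral>e. (norm (\<Sum>k<K. D k e))\<^sup>2 \<partial>M) = (\<Sum>k<K. \<integral>e. (norm (D k e))\<^sup>2 \<partial>M)"
proof (induction K)
  case (Suc K)
  let ?T = "\<lambda>e. \<Sum>k<K. D k e"
  have T: "adapted (past K) ?T"
    by (intro adapted_sum adapted_mono[OF D] past_mono) auto
  note T' = adapted_square_integrable[OF T] and D' = adapted_square_integrable[OF D[of K]]
  have "(norm (\<Sum>k<Suc K. D k e))\<^sup>2 = (norm (?T e))\<^sup>2 + 2 * (?T e \<bullet> D K e) + (norm (D K e))\<^sup>2" for e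
    by (simp add: power2_norm_eq_inner inner_simps inner_commute)
  then have "(\<integral>e. (norm (\<Sum>k<Suc K. D k e))\<^sup>2 \<partial>M)
      = (\<integral>e. (norm (?T e))\<^sup>2 \<partial>M) + (\<integral>e. (norm (D K e))\<^sup>2 \<partial>M)"
    using orth[OF T] square_integrable_norm[OF T'] square_integrable_norm[OF D']
      square_integrable_inner[OF T' D'] by simp
  then show ?case using Suc by simp
qed simp

lemma
  assumes "U \<in> borel_measurable (knowing (past k))" "integrable M U"
  shows integrable_centred_coin: "integrable M (\<lambda>e. (of_bool (coin k e) - p) * U e)"
    and expectation_centred_coin: "(\<integral>e. (of_bool (coin k e) - p) * U e \<partial>M) = 0"
    and integrable_centred_coin_sq: "integrable M (\<lambda>e. (of_bool (coin k e) - p)\<^sup>2 * U e)"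
    and expectation_centred_coin_sq:
      "(\<integral>e. (of_bool (coin k e) - p)\<^sup>2 * U e \<partial>M) = p * (1 - p) * (\<integral>e. U e \<partial>M)"
proof -
  have J: "Coin k \<notin> past k" by (simp add: past_def)
  show "integrable M (\<lambda>e. (of_bool (coin k e) - p) * U e)"
    by (rule integrable_coin[OF J assms, of "\<lambda>c. of_bool c - p"])
  show "integrable M (\<lambda>e. (of_bool (coin k e) - p)\<^sup>2 * U e)"
    by (rule integrable_coin[OF J assms, of "\<lambda>c. (of_bool c - p)\<^sup>2"])
  have "(\<integral>e. (of_bool (coin k e) - p) * U e \<partial>M) = (p * (1 - p) + (1 - p) * (0 - p)) * (\<integral>e. U e \<partial>M)"
    using expectation_coin[OF J assms, of "\<lambda>c. of_bool c - p"] by simp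
  then show "(\<integral>e. (of_bool (coin k e) - p) * U e \<partial>M) = 0" by (simp add: algebra_simps)
  have "(\<integral>e. (of_bool (coin k e) - p)\<^sup>2 * U e \<partial>M)
      = (p * (1 - p)\<^sup>2 + (1 - p) * (0 - p)\<^sup>2) * (\<integral>e. U e \<partial>M)"
    using expectation_coin[OF J assms, of "\<lambda>c. (of_bool c - p)\<^sup>2"] by simp
  also have "p * (1 - p)\<^sup>2 + (1 - p) * (0 - p)\<^sup>2 = p * (1 - p)"
    by (simp add: power2_eq_square algebra_simps)
  finally show "(\<integral>e. (of_bool (coin k e) - p)\<^sup>2 * U e \<partial>M) = p * (1 - p) * (\<integral>e. U e \<partial>M)" .
qed

text \<open>One statement for both noisy updates: \<open>N\<close> will be \<open>At \<xi>\<close>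
  with x and w as \<open>a\<close> and \<open>b\<close>, or \<open>- \<zeta>\<close> with y and u.
  The vector \<open>D\<close> is the random coefficient of the comparator, and the remaining two
  claims concern the offset that is free of it.\<close>

lemma
  fixes N a b T :: "'w \<Rightarrow> 'e::euclidean_space" and k :: nat and c :: real and v :: 'e
  assumes N: "adapted (past (Suc k)) N" "\<And>T. adapted (past k) T \<Longrightarrow> (\<integral>e. T e \<bullet> N e \<partial>M) = 0"
    and a: "adapted (past k) a" and b: "adapted (past k) b"
  defines "D \<equiv> \<lambda>e. c *\<^sub>R N e - (2 * (of_bool (coin k e) - p)) *\<^sub>R (a e - b e)"
  shows adapted_increment: "adapted (past (Suc k)) D"
    and increment_orth: "adapted (past k) T \<Longrightarrow> (\<integral>e. T e \<bullet> D e \<partial>M) = 0"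
    and increment_sq: "(\<integral>e. (norm (D e))\<^sup>2 \<partial>M)
      \<le> 2 * c\<^sup>2 * (\<integral>e. (norm (N e))\<^sup>2 \<partial>M) + 8 * (p * (1 - p) * (\<integral>e. (norm (a e - b e))\<^sup>2 \<partial>M))"
    and integrable_offset: "adapted (past k) T \<Longrightarrow>
      integrable M (\<lambda>e. (of_bool (coin k e) - p) * ((norm (a e - v))\<^sup>2 - (norm (b e - v))\<^sup>2) - c * (N e \<bullet> T e))"
    and expectation_offset: "adapted (past k) T \<Longrightarrow>
      (\<integral>e. (of_bool (coin k e) - p) * ((norm (a e - v))\<^sup>2 - (norm (b e - v))\<^sup>2) - c * (N e \<bullet> T e) \<partial>M) = 0"
proof -
  note N' = adapted_square_integrable[OF N(1)]
  have ab: "adapted (past k) (\<lambda>e. a e - b e)" by (intro adapted_diff a b)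
  note ab' = adapted_square_integrable[OF ab]
  have le: "past k \<subseteq> past (Suc k)" by (simp add: past_mono)
  show D: "adapted (past (Suc k)) D"
    unfolding D_def
    by (intro adapted_diff[OF adapted_scaleR[OF N(1)]] adapted_coin_scaleR adapted_mono[OF ab le])
      (simp add: past_def)
  have sq_meas: "(\<lambda>e. (norm (V e))\<^sup>2) \<in> borel_measurable (knowing J)" if "adapted J V" for J and V :: "'w \<Rightarrow> 'e"
    using that by (auto simp: adapted_def)
  show "(\<integral>e. T e \<bullet> D e \<partial>M) = 0" if T: "adapted (past k) T" for T
  proof -
    have U: "(\<lambda>e. T e \<bullet> (a e - b e)) \<in> borel_measurable (knowing (past k))" "integrable M (\<lambda>e. T e \<bullet> (a e - b e))"
      using T ab square_integrable_inner[OF adapted_square_integrable[OF T] ab'] by (auto simp: adapted_def)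
    have "(\<integral>e. T e \<bullet> D e \<partial>M)
        = (\<integral>e. c * (T e \<bullet> N e) - 2 * ((of_bool (coin k e) - p) * (T e \<bullet> (a e - b e))) \<partial>M)"
      unfolding D_def by (simp add: inner_diff_right algebra_simps)
    also have "\<dots> = c * (\<integral>e. T e \<bullet> N e \<partial>M)
        - 2 * (\<integral>e. (of_bool (coin k e) - p) * (T e \<bullet> (a e - b e)) \<partial>M)"
      using integrable_centred_coin[OF U] square_integrable_inner[OF adapted_square_integrable[OF T] N']
      by simp
    finally show ?thesis using N(2)[OF T] expectation_centred_coin[OF U] by simp
  qed
  show "(\<integral>e. (norm (D e))\<^sup>2 \<partial>M)
      \<le> 2 * c\<^sup>2 * (\<integral>e. (norm (N e))\<^sup>2 \<partial>M) + 8 * (p * (1 - p) * (\<integral>e. (norm (a e - b e))\<^sup>2 \<partial>M))"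
  proof -
    note U = sq_meas[OF ab] square_integrable_norm[OF ab']
    note i = integrable_centred_coin_sq[OF U]
    \<comment> \<open>The factors 2 and 8 = 2 * 2^2 come from |a + b|^2 <= 2 |a|^2 + 2 |b|^2, so the
      correlation of \<open>N\<close> with the coin does not have to be computed.\<close>
    have "(norm (D e))\<^sup>2 \<le> 2 * c\<^sup>2 * (norm (N e))\<^sup>2
        + 8 * ((of_bool (coin k e) - p)\<^sup>2 * (norm (a e - b e))\<^sup>2)" for e
    proof -
      have "(norm (c *\<^sub>R N e - (2 * t) *\<^sub>R (a e - b e)))\<^sup>2
          \<le> 2 * c\<^sup>2 * (norm (N e))\<^sup>2 + 8 * (t\<^sup>2 * (norm (a e - b e))\<^sup>2)" for t
        using norm_add_sq_le[of "c *\<^sub>R N e" "- ((2 * t) *\<^sub>R (a e - b e))"]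
        by (simp add: power_mult_distrib)
      then show ?thesis unfolding D_def .
    qed
    then have "(\<integral>e. (norm (D e))\<^sup>2 \<partial>M) \<le> (\<integral>e. 2 * c\<^sup>2 * (norm (N e))\<^sup>2
        + 8 * ((of_bool (coin k e) - p)\<^sup>2 * (norm (a e - b e))\<^sup>2) \<partial>M)"
      using square_integrable_norm[OF adapted_square_integrable[OF D]] square_integrable_norm[OF N'] i
      by (intro integral_mono) auto
    also have "\<dots> = 2 * c\<^sup>2 * (\<integral>e. (norm (N e))\<^sup>2 \<partial>M)
        + 8 * (p * (1 - p) * (\<integral>e. (norm (a e - b e))\<^sup>2 \<partial>M))"
      using square_integrable_norm[OF N'] i expectation_centred_coin_sq[OF U] by simp
    finally show ?thesis .
  qed
  assume T: "adapted (past k) T"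
  have av: "adapted (past k) (\<lambda>e. a e - v)" and bv: "adapted (past k) (\<lambda>e. b e - v)"
    by (intro adapted_diff a b adapted_const)+
  have U: "(\<lambda>e. (norm (a e - v))\<^sup>2 - (norm (b e - v))\<^sup>2) \<in> borel_measurable (knowing (past k))"
    "integrable M (\<lambda>e. (norm (a e - v))\<^sup>2 - (norm (b e - v))\<^sup>2)"
    using sq_meas[OF av] sq_meas[OF bv] square_integrable_norm[OF adapted_square_integrable[OF av]]
      square_integrable_norm[OF adapted_square_integrable[OF bv]] by auto
  note i = integrable_centred_coin[OF U] square_integrable_inner[OF N' adapted_square_integrable[OF T]]
  show "integrable M (\<lambda>e. (of_bool (coin k e) - p) * ((norm (a e - v))\<^sup>2 - (norm (b e - v))\<^sup>2) - c * (N e \<bullet> T e))"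
    using i by simp
  show "(\<integral>e. (of_bool (coin k e) - p) * ((norm (a e - v))\<^sup>2 - (norm (b e - v))\<^sup>2) - c * (N e \<bullet> T e) \<partial>M) = 0"
    using i expectation_centred_coin[OF U] N(2)[OF T] by (simp add: inner_commute)
qed

end

section \<open>Descent identity and absorption of all errors\<close>

context compressed_extragradient
begin

text \<open>The coefficient of X - x0 in one step: the only place where randomness of mean zero
  multiplies the comparator.\<close>

definition x_drift :: "nat \<Rightarrow> 'w \<Rightarrow> 'a" where
  "x_drift k e = (2 * \<gamma>) *\<^sub>R At (\<xi> k e) - (2 * (of_bool (coin k e) - p)) *\<^sub>R (x k e - w k e)"

definition y_drift :: "nat \<Rightarrow> 'w \<Rightarrow> real ^ 's" where
  "y_drift k e = (2 * \<gamma>) *\<^sub>R (- \<zeta> k e) - (2 * (of_bool (coin k e) - p)) *\<^sub>R (y k e - u k e)"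

definition x_offset :: "nat \<Rightarrow> 'w \<Rightarrow> real" where
  "x_offset k e = (of_bool (coin k e) - p) * ((norm (x k e - x0))\<^sup>2 - (norm (w k e - x0))\<^sup>2)
     - 2 * \<gamma> * (At (\<xi> k e) \<bullet> (xh k e - x0))"

definition y_offset :: "nat \<Rightarrow> 'w \<Rightarrow> real" where
  "y_offset k e = (of_bool (coin k e) - p) * ((norm (y k e - y0))\<^sup>2 - (norm (u k e - y0))\<^sup>2)
     - 2 * \<gamma> * (- \<zeta> k e \<bullet> (yh k e - y0))"

text \<open>Noise and gradient change merge: \<open>At (yh - u)\<close> plus \<open>At \<xi>\<close>
  is \<open>At\<close> of the compressed message, whose second moment the compressor bounds
  directly. The sum of the messages in \<open>y_error\<close> arises in the same way.\<close>

definition x_error :: "nat \<Rightarrow> 'w \<Rightarrow> real" where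
  "x_error k e = \<gamma>\<^sup>2 * (norm (At (Q (bc k e) (yh k e - u k e)) + (gr (xh k e) - gr (x k e))))\<^sup>2
     - (1 - p) * (norm (xh k e - x k e))\<^sup>2 - p * (norm (xh k e - w k e))\<^sup>2"

definition z_error :: "nat \<Rightarrow> 'w \<Rightarrow> real" where
  "z_error k e = \<gamma>\<^sup>2 * (norm ((gl (zh k e) - gl (z k e)) + (y k e - yh k e)))\<^sup>2 - (norm (zh k e - z k e))\<^sup>2"

definition y_error :: "nat \<Rightarrow> 'w \<Rightarrow> real" where
  "y_error k e = \<gamma>\<^sup>2 * (norm (- (\<Sum>i\<in>UNIV. Q (up k i e) (A i (xh k e - w k e))) + (zh k e - z k e)))\<^sup>2
     - (1 - p) * (norm (yh k e - y k e))\<^sup>2 - p * (norm (yh k e - u k e))\<^sup>2"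

text \<open>The saddle operator at the half step, paired with the displacement from the comparator.
  By convexity it dominates the difference of Lagrangians that the gap maximises.\<close>

definition linearized_gap :: "nat \<Rightarrow> 'w \<Rightarrow> 'a \<Rightarrow> real ^ 's \<Rightarrow> real ^ 's \<Rightarrow> real" where
  "linearized_gap k e X Z Y = (At (yh k e) + gr (xh k e)) \<bullet> (xh k e - X)
     + (gl (zh k e) - yh k e) \<bullet> (zh k e - Z) + (zh k e - (\<Sum>i\<in>UNIV. A i (xh k e))) \<bullet> (yh k e - Y)"

definition potential :: "nat \<Rightarrow> 'w \<Rightarrow> 'a \<Rightarrow> real ^ 's \<Rightarrow> real ^ 's \<Rightarrow> real" where
  "potential k e X Z Y = (norm (x k e - X))\<^sup>2 + (norm (w k e - X))\<^sup>2 + (norm (z k e - Z))\<^sup>2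
     + (norm (y k e - Y))\<^sup>2 + (norm (u k e - Y))\<^sup>2"

definition residual :: "nat \<Rightarrow> 'w \<Rightarrow> real" where
  "residual k e = x_offset k e + y_offset k e + x_error k e + z_error k e + y_error k e"

lemma descent_step:
  "2 * \<gamma> * linearized_gap k e X Z Y = potential k e X Z Y - potential (Suc k) e X Z Y
     + x_drift k e \<bullet> (X - x0) + y_drift k e \<bullet> (Y - y0) + residual k e"
proof -
  have "x (Suc k) e = (1 - p) *\<^sub>R x k e + p *\<^sub>R w k e - \<gamma> *\<^sub>R ((At (yh k e) + gr (xh k e)) + At (\<xi> k e))"
    by (simp add: x_Suc \<xi>_def At_add At_diff algebra_simps)
  from noisy_extragradient_step[OF this xh w_Suc, of X x0]
  have x: "2 * \<gamma> * ((At (yh k e) + gr (xh k e)) \<bullet> (xh k e - X)) =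
      ((norm (x k e - X))\<^sup>2 + (norm (w k e - X))\<^sup>2) - ((norm (x (Suc k) e - X))\<^sup>2 + (norm (w (Suc k) e - X))\<^sup>2)
      + x_drift k e \<bullet> (X - x0) + x_offset k e + x_error k e"
    unfolding x_drift_def x_offset_def x_error_def by (simp add: \<xi>_def At_add At_diff algebra_simps)
  \<comment> \<open>The update of z is the case p = 0 of the identity, with z serving as its own
    anchor.\<close>
  have "z (Suc k) e = (1 - 0) *\<^sub>R z k e + 0 *\<^sub>R z k e - \<gamma> *\<^sub>R (gl (zh k e) - yh k e)"
    "zh k e = (1 - 0) *\<^sub>R z k e + 0 *\<^sub>R z k e - \<gamma> *\<^sub>R (gl (z k e) - y k e)"
    by (simp_all add: z_Suc zh)
  from extragradient_step[OF this, of Z]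
  have z: "2 * \<gamma> * ((gl (zh k e) - yh k e) \<bullet> (zh k e - Z))
      = (norm (z k e - Z))\<^sup>2 - (norm (z (Suc k) e - Z))\<^sup>2 + z_error k e"
    unfolding z_error_def by (simp add: algebra_simps)
  have sums: "(\<Sum>i\<in>UNIV. Q (up k i e) (A i (xh k e - w k e)))
      = \<zeta> k e + (\<Sum>i\<in>UNIV. A i (xh k e)) - (\<Sum>i\<in>UNIV. A i (w k e))"
    by (simp add: \<zeta>_def A_diff sum_subtractf sum.distrib)
  have y1: "y (Suc k) e = (1 - p) *\<^sub>R y k e + p *\<^sub>R u k e
      - \<gamma> *\<^sub>R ((zh k e - (\<Sum>i\<in>UNIV. A i (xh k e))) + (- \<zeta> k e))"
    unfolding y_Suc sum.distrib sums by (simp add: algebra_simps)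
  have y2: "yh k e = (1 - p) *\<^sub>R y k e + p *\<^sub>R u k e - \<gamma> *\<^sub>R (z k e - (\<Sum>i\<in>UNIV. A i (w k e)))"
    by (simp add: yh algebra_simps)
  have "- (\<Sum>i\<in>UNIV. Q (up k i e) (A i (xh k e - w k e))) + (zh k e - z k e)
      = (zh k e - (\<Sum>i\<in>UNIV. A i (xh k e))) + (- \<zeta> k e) - (z k e - (\<Sum>i\<in>UNIV. A i (w k e)))"
    unfolding sums by simp
  with noisy_extragradient_step[OF y1 y2 u_Suc, of Y y0]
  have y: "2 * \<gamma> * ((zh k e - (\<Sum>i\<in>UNIV. A i (xh k e))) \<bullet> (yh k e - Y)) =
      ((norm (y k e - Y))\<^sup>2 + (norm (u k e - Y))\<^sup>2) - ((norm (y (Suc k) e - Y))\<^sup>2 + (norm (u (Suc k) e - Y))\<^sup>2)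
      + y_drift k e \<bullet> (Y - y0) + y_offset k e + y_error k e"
    unfolding y_drift_def y_offset_def y_error_def by (simp only:)
  show ?thesis
    unfolding linearized_gap_def potential_def residual_def distrib_left x y z by simp
qed

lemma descent_sum:
  "2 * \<gamma> * (\<Sum>k<K. linearized_gap k e X Z Y) = potential 0 e X Z Y - potential K e X Z Y
     + (\<Sum>k<K. x_drift k e) \<bullet> (X - x0) + (\<Sum>k<K. y_drift k e) \<bullet> (Y - y0) + (\<Sum>k<K. residual k e)"
proof (induction K)
  case (Suc K)
  then show ?case using descent_step[of K e X Z Y] by (simp add: inner_add_left distrib_left)
qed simp

text \<open>Everything random that survives once the drifts are separated from the comparator by
  \<open>inner_le_weighted\<close>. It is free of X, Z and Y, so a supremum over them may be taken
  before the expectation.\<close>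

definition fluctuation :: "nat \<Rightarrow> 'w \<Rightarrow> real" where
  "fluctuation K e = 1 / 100 * (norm (\<Sum>k<K. x_drift k e))\<^sup>2
     + 1 / 100 * (norm (\<Sum>k<K. y_drift k e))\<^sup>2 + (\<Sum>k<K. residual k e)"

text \<open>Here 28 = 1 + 2 + 25: the initial distance itself, twice that distance from splitting
  |w0 - X|^2 at x0, and the weight of \<open>inner_le_weighted\<close>. The other half of the split
  leaves 2 |w0 - x0|^2; likewise for y and u.\<close>

lemma linearized_gap_sum_le:
  "2 * \<gamma> * (\<Sum>k<K. linearized_gap k e X Z Y) \<le>
     28 * ((norm (x0 - X))\<^sup>2 + (norm (z0 - Z))\<^sup>2 + (norm (y0 - Y))\<^sup>2)
     + 2 * ((norm (w0 - x0))\<^sup>2 + (norm (u0 - y0))\<^sup>2) + fluctuation K e"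
proof -
  have "0 \<le> potential K e X Z Y" by (simp add: potential_def)
  moreover have "potential 0 e X Z Y = (norm (x0 - X))\<^sup>2 + (norm (w0 - X))\<^sup>2 + (norm (z0 - Z))\<^sup>2
     + (norm (y0 - Y))\<^sup>2 + (norm (u0 - Y))\<^sup>2" by (simp add: potential_def init)
  moreover have "(norm (w0 - X))\<^sup>2 \<le> 2 * (norm (w0 - x0))\<^sup>2 + 2 * (norm (x0 - X))\<^sup>2"
    "(norm (u0 - Y))\<^sup>2 \<le> 2 * (norm (u0 - y0))\<^sup>2 + 2 * (norm (y0 - Y))\<^sup>2"
    using norm_add_sq_le[of "w0 - x0" "x0 - X"] norm_add_sq_le[of "u0 - y0" "y0 - Y"] by simp_all
  moreover have "(norm (X - x0))\<^sup>2 = (norm (x0 - X))\<^sup>2" "(norm (Y - y0))\<^sup>2 = (norm (y0 - Y))\<^sup>2"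
    by (simp_all add: norm_minus_commute)
  moreover have "0 \<le> (norm (z0 - Z))\<^sup>2" by simp
  ultimately show ?thesis
    using inner_le_weighted[of "\<Sum>k<K. x_drift k e" "X - x0"]
      inner_le_weighted[of "\<Sum>k<K. y_drift k e" "Y - y0"]
    unfolding descent_sum fluctuation_def distrib_left by linarith
qed

lemma adapted_At_\<xi>: "adapted (past (Suc k)) (\<lambda>e. At (\<xi> k e))"
  by (intro adapted_linear[OF _ At_linear] adapted_mono[OF adapted_\<xi>]) (auto simp: past_def)

lemma At_\<xi>_orth: "adapted (past k) T \<Longrightarrow> (\<integral>e. T e \<bullet> At (\<xi> k e) \<partial>M) = 0"
proof -
  assume T: "adapted (past k) T"
  have "T e \<bullet> At (\<xi> k e) = (\<Sum>i\<in>UNIV. A i (T e)) \<bullet> \<xi> k e" for e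
    using At_adjoint[of "\<xi> k e" "T e"] by (simp add: inner_commute)
  moreover have "adapted (past k) (\<lambda>e. \<Sum>i\<in>UNIV. A i (T e))"
    by (intro adapted_sum adapted_linear[OF T A_linear])
  ultimately show ?thesis using \<xi>_orth[of k "\<lambda>e. \<Sum>i\<in>UNIV. A i (T e)"] by simp
qed

lemma adapted_minus_\<zeta>: "adapted (past (Suc k)) (\<lambda>e. - \<zeta> k e)"
proof -
  have "range (Upload k) \<union> past k \<subseteq> past (Suc k)" by (auto simp: past_def)
  from adapted_scaleR[OF adapted_mono[OF adapted_\<zeta> this], of "-1"] show ?thesis by simp
qed

lemma minus_\<zeta>_orth: "adapted (past k) T \<Longrightarrow> (\<integral>e. T e \<bullet> - \<zeta> k e \<partial>M) = 0"
  using \<zeta>_orth[of k T] by simp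

lemmas x_increment =
  adapted_increment[OF adapted_At_\<xi> At_\<xi>_orth adapted_iterates(1) adapted_iterates(4), where c = "2 * \<gamma>"]
  increment_orth[OF adapted_At_\<xi> At_\<xi>_orth adapted_iterates(1) adapted_iterates(4), where c = "2 * \<gamma>"]
  increment_sq[OF adapted_At_\<xi> At_\<xi>_orth adapted_iterates(1) adapted_iterates(4), where c = "2 * \<gamma>"]

lemmas y_increment =
  adapted_increment[OF adapted_minus_\<zeta> minus_\<zeta>_orth adapted_iterates(3) adapted_iterates(5), where c = "2 * \<gamma>"]
  increment_orth[OF adapted_minus_\<zeta> minus_\<zeta>_orth adapted_iterates(3) adapted_iterates(5), where c = "2 * \<gamma>"]
  increment_sq[OF adapted_minus_\<zeta> minus_\<zeta>_orth adapted_iterates(3) adapted_iterates(5), where c = "2 * \<gamma>"]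

lemma
  shows adapted_x_drift: "adapted (past (Suc k)) (x_drift k)"
    and x_drift_orth: "adapted (past k) T \<Longrightarrow> (\<integral>e. T e \<bullet> x_drift k e \<partial>M) = 0"
    and adapted_y_drift: "adapted (past (Suc k)) (y_drift k)"
    and y_drift_orth: "adapted (past k) T' \<Longrightarrow> (\<integral>e. T' e \<bullet> y_drift k e \<partial>M) = 0"
  unfolding x_drift_def[abs_def] y_drift_def[abs_def]
  using x_increment y_increment by blast+

lemma
  shows integrable_x_offset: "integrable M (x_offset k)" and expectation_x_offset: "(\<integral>e. x_offset k e \<partial>M) = 0"
    and integrable_y_offset: "integrable M (y_offset k)" and expectation_y_offset: "(\<integral>e. y_offset k e \<partial>M) = 0"
proof -
  have x: "adapted (past k) (\<lambda>e. xh k e - x0)" and y: "adapted (past k) (\<lambda>e. yh k e - y0)"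
    by (intro adapted_diff adapted_iterates adapted_const)+
  show "integrable M (x_offset k)" and "integrable M (y_offset k)"
    unfolding x_offset_def[abs_def] y_offset_def[abs_def]
    using integrable_offset[OF adapted_At_\<xi> At_\<xi>_orth adapted_iterates(1) adapted_iterates(4) x]
      integrable_offset[OF adapted_minus_\<zeta> minus_\<zeta>_orth adapted_iterates(3) adapted_iterates(5) y]
    by blast+
  show "(\<integral>e. x_offset k e \<partial>M) = 0" and "(\<integral>e. y_offset k e \<partial>M) = 0"
    unfolding x_offset_def y_offset_def
    using expectation_offset[OF adapted_At_\<xi> At_\<xi>_orth adapted_iterates(1) adapted_iterates(4) x]
      expectation_offset[OF adapted_minus_\<zeta> minus_\<zeta>_orth adapted_iterates(3) adapted_iterates(5) y]
    by blast+
qed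

text \<open>Each positive term is charged to a negative one: the messages to |yh - u|^2 and |xh -
  w|^2, the gradient changes to |xh - x|^2 and |zh - z|^2, the coupling of z and y to |yh - y|^2 and
  |zh - z|^2, and the coin by \<open>anchor_distance\<close> to the x and y distances.\<close>

lemma fluctuation_step:
  "(\<integral>e. 1 / 100 * (norm (x_drift k e))\<^sup>2 + 1 / 100 * (norm (y_drift k e))\<^sup>2
     + (x_error k e + z_error k e + y_error k e) \<partial>M) \<le> 0"
  and integrable_x_error: "integrable M (x_error k)"
  and integrable_z_error: "integrable M (z_error k)"
  and integrable_y_error: "integrable M (y_error k)"
proof -
  have pp: "0 < p" "p \<le> 9 / 10" by (fact p)+
  have sq: "adapted (past k) V \<Longrightarrow> integrable M (\<lambda>e. (norm (V e))\<^sup>2)" for V :: "'w \<Rightarrow> 'e::euclidean_space"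
    by (intro square_integrable_norm adapted_square_integrable)
  define xx xw yy yu zz xwd yud where
    "xx e = (norm (xh k e - x k e))\<^sup>2" and "xw e = (norm (xh k e - w k e))\<^sup>2"
    and "yy e = (norm (yh k e - y k e))\<^sup>2" and "yu e = (norm (yh k e - u k e))\<^sup>2"
    and "zz e = (norm (zh k e - z k e))\<^sup>2" and "xwd e = (norm (x k e - w k e))\<^sup>2"
    and "yud e = (norm (y k e - u k e))\<^sup>2" for e
  have int: "integrable M xx" "integrable M xw" "integrable M yy" "integrable M yu" "integrable M zz"
    "integrable M xwd" "integrable M yud"
    unfolding xx_def xw_def yy_def yu_def zz_def xwd_def yud_def
    by (intro sq adapted_diff adapted_iterates)+
  have nonneg: "0 \<le> (\<integral>e. xx e \<partial>M)" "0 \<le> (\<integral>e. xw e \<partial>M)" "0 \<le> (\<integral>e. yy e \<partial>M)" "0 \<le> (\<integral>e. yu e \<partial>M)"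
    "0 \<le> (\<integral>e. zz e \<partial>M)"
    by (simp_all add: xx_def xw_def yy_def yu_def zz_def)

  let ?q = "\<lambda>e. Q (bc k e) (yh k e - u k e)" and ?s = "\<lambda>e. \<Sum>i\<in>UNIV. Q (up k i e) (A i (xh k e - w k e))"
  have q: "square_integrable M ?q" and s: "square_integrable M ?s"
    and \<xi>: "square_integrable M (\<xi> k)" and \<zeta>: "square_integrable M (\<zeta> k)"
    by (rule q_square_integrable s_square_integrable \<xi>_square_integrable \<zeta>_square_integrable)+
  have scale: "\<gamma>\<^sup>2 * (lam * a) \<le> p / 16 * b" if "a \<le> om * b" "0 \<le> b" for a b
  proof -
    have "\<gamma>\<^sup>2 * (lam * a) \<le> \<gamma>\<^sup>2 * (lam * (om * b))"
      using that lam by (intro mult_left_mono) auto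
    also have "\<dots> = (\<gamma>\<^sup>2 * (om * lam)) * b" by simp
    also have "\<dots> \<le> p / 16 * b" using that \<gamma>(5) by (intro mult_right_mono)
    finally show ?thesis .
  qed
  have scale': "\<gamma>\<^sup>2 * a \<le> p / 16 * b" if "a \<le> om * lam * b" "0 \<le> b" for a b
  proof -
    have "\<gamma>\<^sup>2 * a \<le> \<gamma>\<^sup>2 * (om * lam * b)" using that by (intro mult_left_mono) auto
    also have "\<dots> = (\<gamma>\<^sup>2 * (om * lam)) * b" by simp
    also have "\<dots> \<le> p / 16 * b" using that \<gamma>(5) by (intro mult_right_mono)
    finally show ?thesis .
  qed
  have q_le: "\<gamma>\<^sup>2 * (lam * (\<integral>e. (norm (?q e))\<^sup>2 \<partial>M)) \<le> p / 16 * (\<integral>e. yu e \<partial>M)"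
    and \<xi>_le: "\<gamma>\<^sup>2 * (lam * (\<integral>e. (norm (\<xi> k e))\<^sup>2 \<partial>M)) \<le> p / 16 * (\<integral>e. yu e \<partial>M)"
    using scale[OF q_sq] scale[OF \<xi>_sq] unfolding yu_def by simp_all
  have s_le: "\<gamma>\<^sup>2 * (\<integral>e. (norm (?s e))\<^sup>2 \<partial>M) \<le> p / 16 * (\<integral>e. xw e \<partial>M)"
    and \<zeta>_le: "\<gamma>\<^sup>2 * (\<integral>e. (norm (\<zeta> k e))\<^sup>2 \<partial>M) \<le> p / 16 * (\<integral>e. xw e \<partial>M)"
    using scale'[OF s_sq] scale'[OF \<zeta>_sq] unfolding xw_def by simp_all
  have lip: "\<gamma>\<^sup>2 * a\<^sup>2 \<le> 1 / 16 * b\<^sup>2" if "a \<le> L * b" "0 \<le> a" "0 \<le> b" "\<gamma> * L \<le> 1 / 4" for a b L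
  proof -
    have "\<gamma> * a \<le> (\<gamma> * L) * b" using that \<gamma>(1) by (simp add: mult.assoc)
    also have "\<dots> \<le> 1 / 4 * b" using that by (intro mult_right_mono)
    finally have "(\<gamma> * a)\<^sup>2 \<le> (1 / 4 * b)\<^sup>2" using that \<gamma>(1) by (intro power_mono) auto
    then show ?thesis by (simp add: power_mult_distrib power_divide)
  qed
  \<comment> \<open>Handles the direct coupling between z and y, where no Lipschitz constant
    appears; this is the use of \<gamma> <= 1/4.\<close>
  have \<gamma>_sq: "\<gamma>\<^sup>2 * a \<le> 1 / 16 * a" if "0 \<le> a" for a
    using power_mono[OF \<gamma>(2), of 2] \<gamma>(1) that by (intro mult_right_mono) (auto simp: power2_eq_square)

  have gr_sq: "\<gamma>\<^sup>2 * (norm (gr (xh k e) - gr (x k e)))\<^sup>2 \<le> 1 / 16 * xx e" for e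
    unfolding xx_def by (rule lip[OF gr_lipschitz]) (use \<gamma> in auto)
  have gl_sq: "\<gamma>\<^sup>2 * (norm (gl (zh k e) - gl (z k e)))\<^sup>2 \<le> 1 / 16 * zz e" for e
    unfolding zz_def by (rule lip[OF gl_lipschitz]) (use \<gamma> in auto)

  have At_q_sq: "integrable M (\<lambda>e. (norm (At (?q e) + (gr (xh k e) - gr (x k e))))\<^sup>2)"
    by (intro square_integrable_norm square_integrable_add square_integrable_diff
        square_integrable_linear[OF q At_linear]
        adapted_square_integrable[where J = "past k"] adapted_lipschitz[OF _ gr_lipschitz] adapted_iterates)
  then show x_int: "integrable M (x_error k)"
    unfolding x_error_def[abs_def] xx_def[symmetric] xw_def[symmetric] using int by simp
  have "integrable M (\<lambda>e. (norm ((gl (zh k e) - gl (z k e)) + (y k e - yh k e)))\<^sup>2)"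
    by (intro sq adapted_add adapted_diff adapted_lipschitz[OF _ gl_lipschitz] adapted_iterates)
  then show z_int: "integrable M (z_error k)"
    unfolding z_error_def[abs_def] zz_def[symmetric] using int by simp
  have "integrable M (\<lambda>e. (norm (- ?s e + (zh k e - z k e)))\<^sup>2)"
    by (intro square_integrable_norm square_integrable_add square_integrable_minus s
        adapted_square_integrable[where J = "past k"] adapted_diff adapted_iterates)
  then show y_int: "integrable M (y_error k)"
    unfolding y_error_def[abs_def] yy_def[symmetric] yu_def[symmetric] using int by simp

  \<comment> \<open>The weights of \<open>young_sq\<close> meet the stepsize bounds: 4/3 * 1/16 =
    1/12 for the gradient change, and below 4 * p/16 = p/4 for the message.\<close>
  have "x_error k e \<le> 4 * (\<gamma>\<^sup>2 * (lam * (norm (?q e))\<^sup>2)) + (1 / 12 - (1 - p)) * xx e - p * xw e" for e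
  proof -
    have "\<gamma>\<^sup>2 * (norm (At (?q e) + (gr (xh k e) - gr (x k e))))\<^sup>2
        \<le> \<gamma>\<^sup>2 * (4 * (lam * (norm (?q e))\<^sup>2) + 4 / 3 * (norm (gr (xh k e) - gr (x k e)))\<^sup>2)"
      using young_sq[of "At (?q e)"] At_bound[of "?q e"] by (intro mult_left_mono) (force intro: order_trans)+
    also have "\<dots> \<le> 4 * (\<gamma>\<^sup>2 * (lam * (norm (?q e))\<^sup>2)) + 1 / 12 * xx e"
      using gr_sq[of e] unfolding distrib_left by linarith
    finally show ?thesis
      unfolding x_error_def xx_def[symmetric] xw_def[symmetric] left_diff_distrib by linarith
  qed
  then have "(\<integral>e. x_error k e \<partial>M)
      \<le> (\<integral>e. 4 * (\<gamma>\<^sup>2 * (lam * (norm (?q e))\<^sup>2)) + (1 / 12 - (1 - p)) * xx e - p * xw e \<partial>M)"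
    using int square_integrable_norm[OF q] by (intro integral_mono x_int) auto
  also have "\<dots> = 4 * (\<gamma>\<^sup>2 * (lam * (\<integral>e. (norm (?q e))\<^sup>2 \<partial>M)))
      + (1 / 12 - (1 - p)) * (\<integral>e. xx e \<partial>M) - p * (\<integral>e. xw e \<partial>M)"
    using int square_integrable_norm[OF q] by simp
  finally have x_le: "(\<integral>e. x_error k e \<partial>M) \<le> p / 4 * (\<integral>e. yu e \<partial>M)
      + (1 / 12 - (1 - p)) * (\<integral>e. xx e \<partial>M) - p * (\<integral>e. xw e \<partial>M)"
    using q_le by linarith

  \<comment> \<open>Here the gradient change takes the weight 4, costing 4/16 of |zh - z|^2 and
    leaving 3/4. The small weight goes to |yh - y|^2, whose coefficient 1 - p may be as small as
    1/10.\<close>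
  have "z_error k e \<le> 1 / 12 * yy e - 3 / 4 * zz e" for e
  proof -
    have "\<gamma>\<^sup>2 * (norm ((gl (zh k e) - gl (z k e)) + (y k e - yh k e)))\<^sup>2
        \<le> \<gamma>\<^sup>2 * (4 * (norm (gl (zh k e) - gl (z k e)))\<^sup>2 + 4 / 3 * yy e)"
      using young_sq[of "gl (zh k e) - gl (z k e)" "y k e - yh k e"]
      unfolding yy_def norm_minus_commute[of "yh k e"] by (intro mult_left_mono) auto
    also have "\<dots> \<le> 1 / 4 * zz e + 1 / 12 * yy e"
      using gl_sq[of e] \<gamma>_sq[of "yy e"] unfolding distrib_left by (simp add: yy_def)
    finally show ?thesis unfolding z_error_def zz_def[symmetric] by linarith
  qed
  then have "(\<integral>e. z_error k e \<partial>M) \<le> (\<integral>e. 1 / 12 * yy e - 3 / 4 * zz e \<partial>M)"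
    using int by (intro integral_mono z_int) auto
  also have "\<dots> = 1 / 12 * (\<integral>e. yy e \<partial>M) - 3 / 4 * (\<integral>e. zz e \<partial>M)"
    using int by simp
  finally have z_le: "(\<integral>e. z_error k e \<partial>M) \<le> 1 / 12 * (\<integral>e. yy e \<partial>M) - 3 / 4 * (\<integral>e. zz e \<partial>M)" .

  have "y_error k e \<le> 4 * (\<gamma>\<^sup>2 * (norm (?s e))\<^sup>2) + 1 / 12 * zz e - (1 - p) * yy e - p * yu e" for e
  proof -
    have "\<gamma>\<^sup>2 * (norm (- ?s e + (zh k e - z k e)))\<^sup>2 \<le> \<gamma>\<^sup>2 * (4 * (norm (?s e))\<^sup>2 + 4 / 3 * zz e)"
      using young_sq[of "- ?s e" "zh k e - z k e"] unfolding zz_def by (intro mult_left_mono) auto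
    also have "\<dots> \<le> 4 * (\<gamma>\<^sup>2 * (norm (?s e))\<^sup>2) + 1 / 12 * zz e"
      using \<gamma>_sq[of "zz e"] unfolding distrib_left by (simp add: zz_def)
    finally show ?thesis unfolding y_error_def yy_def[symmetric] yu_def[symmetric] by linarith
  qed
  then have "(\<integral>e. y_error k e \<partial>M)
      \<le> (\<integral>e. 4 * (\<gamma>\<^sup>2 * (norm (?s e))\<^sup>2) + 1 / 12 * zz e - (1 - p) * yy e - p * yu e \<partial>M)"
    using int square_integrable_norm[OF s] by (intro integral_mono y_int) auto
  also have "\<dots> = 4 * (\<gamma>\<^sup>2 * (\<integral>e. (norm (?s e))\<^sup>2 \<partial>M)) + 1 / 12 * (\<integral>e. zz e \<partial>M)
      - (1 - p) * (\<integral>e. yy e \<partial>M) - p * (\<integral>e. yu e \<partial>M)"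
    using int square_integrable_norm[OF s] by simp
  finally have y_le: "(\<integral>e. y_error k e \<partial>M) \<le> p / 4 * (\<integral>e. xw e \<partial>M) + 1 / 12 * (\<integral>e. zz e \<partial>M)
      - (1 - p) * (\<integral>e. yy e \<partial>M) - p * (\<integral>e. yu e \<partial>M)"
    using s_le by linarith

  have anchor: "p * (1 - p) * (\<integral>e. d e \<partial>M) \<le> (1 - p) * (\<integral>e. a e \<partial>M) + p * (\<integral>e. b e \<partial>M)"
    if "integrable M a" "integrable M b" "integrable M d" "\<And>e. p * (1 - p) * d e \<le> (1 - p) * a e + p * b e"
    for a b d :: "'w \<Rightarrow> real"
  proof -
    have "(\<integral>e. p * (1 - p) * d e \<partial>M) \<le> (\<integral>e. (1 - p) * a e + p * b e \<partial>M)"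
      using that by (intro integral_mono) auto
    then show ?thesis using that by simp
  qed
  have x_anchor: "p * (1 - p) * (\<integral>e. xwd e \<partial>M) \<le> (1 - p) * (\<integral>e. xx e \<partial>M) + p * (\<integral>e. xw e \<partial>M)"
    by (rule anchor[OF int(1,2,6)]) (simp only: xx_def xw_def xwd_def anchor_distance)
  have y_anchor: "p * (1 - p) * (\<integral>e. yud e \<partial>M) \<le> (1 - p) * (\<integral>e. yy e \<partial>M) + p * (\<integral>e. yu e \<partial>M)"
    by (rule anchor[OF int(3,4,7)]) (simp only: yy_def yu_def yud_def anchor_distance)

  \<comment> \<open>The increment bound with c = 2 \<gamma> has the factor 2 c^2 = 8 \<gamma>^2, and
    8 * p/16 = p/2.\<close>
  have combine: "D \<le> p / 2 * b + 8 * c" if "D \<le> 8 * a + 8 * w" "a \<le> p / 16 * b" "w \<le> c" for D a b c w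
    using that by simp
  have "(\<integral>e. (norm (At (\<xi> k e)))\<^sup>2 \<partial>M) \<le> lam * (\<integral>e. (norm (\<xi> k e))\<^sup>2 \<partial>M)"
  proof -
    have "(\<integral>e. (norm (At (\<xi> k e)))\<^sup>2 \<partial>M) \<le> (\<integral>e. lam * (norm (\<xi> k e))\<^sup>2 \<partial>M)"
      using At_bound square_integrable_norm[OF \<xi>]
        square_integrable_norm[OF square_integrable_linear[OF \<xi> At_linear]] by (intro integral_mono) auto
    then show ?thesis by simp
  qed
  then have "\<gamma>\<^sup>2 * (\<integral>e. (norm (At (\<xi> k e)))\<^sup>2 \<partial>M) \<le> p / 16 * (\<integral>e. yu e \<partial>M)"
    using mult_left_mono[of _ _ "\<gamma>\<^sup>2"] \<xi>_le by (smt (verit) zero_le_power2)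
  moreover have "(\<integral>e. (norm (x_drift k e))\<^sup>2 \<partial>M) \<le> 8 * (\<gamma>\<^sup>2 * (\<integral>e. (norm (At (\<xi> k e)))\<^sup>2 \<partial>M))
      + 8 * (p * (1 - p) * (\<integral>e. xwd e \<partial>M))"
    using x_increment(3)[of k] unfolding x_drift_def xwd_def by (simp add: power_mult_distrib mult.assoc)
  ultimately have x_drift: "(\<integral>e. (norm (x_drift k e))\<^sup>2 \<partial>M) \<le> p / 2 * (\<integral>e. yu e \<partial>M)
      + 8 * ((1 - p) * (\<integral>e. xx e \<partial>M) + p * (\<integral>e. xw e \<partial>M))"
    using combine x_anchor by blast
  have "(\<integral>e. (norm (y_drift k e))\<^sup>2 \<partial>M) \<le> 8 * (\<gamma>\<^sup>2 * (\<integral>e. (norm (\<zeta> k e))\<^sup>2 \<partial>M))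
      + 8 * (p * (1 - p) * (\<integral>e. yud e \<partial>M))"
    using y_increment(3)[of k] unfolding y_drift_def yud_def by (simp add: power_mult_distrib mult.assoc)
  then have y_drift: "(\<integral>e. (norm (y_drift k e))\<^sup>2 \<partial>M) \<le> p / 2 * (\<integral>e. xw e \<partial>M)
      + 8 * ((1 - p) * (\<integral>e. yy e \<partial>M) + p * (\<integral>e. yu e \<partial>M))"
    using combine y_anchor \<zeta>_le by blast

  have "(\<integral>e. 1 / 100 * (norm (x_drift k e))\<^sup>2 + 1 / 100 * (norm (y_drift k e))\<^sup>2
     + (x_error k e + z_error k e + y_error k e) \<partial>M)
     = 1 / 100 * (\<integral>e. (norm (x_drift k e))\<^sup>2 \<partial>M) + 1 / 100 * (\<integral>e. (norm (y_drift k e))\<^sup>2 \<partial>M)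
       + ((\<integral>e. x_error k e \<partial>M) + (\<integral>e. z_error k e \<partial>M) + (\<integral>e. y_error k e \<partial>M))"
    using x_int y_int z_int square_integrable_norm[OF adapted_square_integrable[OF adapted_x_drift[of k]]]
      square_integrable_norm[OF adapted_square_integrable[OF adapted_y_drift[of k]]] by simp
  also have "\<dots> \<le> 0"
  proof -
    have "1 / 100 * dx + 1 / 100 * dy + (ex + ez + ey) \<le> 0"
      if "ex \<le> p / 4 * a2 + (1 / 12 - (1 - p)) * a1 - p * b1"
        and "ez \<le> 1 / 12 * b2 - 3 / 4 * c"
        and "ey \<le> p / 4 * b1 + 1 / 12 * c - (1 - p) * b2 - p * a2"
        and "dx \<le> p / 2 * a2 + 8 * ((1 - p) * a1 + p * b1)"
        and "dy \<le> p / 2 * b1 + 8 * ((1 - p) * b2 + p * a2)"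
        and "0 \<le> a1" "0 \<le> b1" "0 \<le> b2" "0 \<le> a2" "0 \<le> c"
      for ex ez ey dx dy a1 a2 b1 b2 c
    proof -
      \<comment> \<open>This fixes the range of p: since 1 - p >= 1/10, the right side is at least
        23/250 of \<open>a\<close>, just above 1/12.\<close>
      have absorb: "1 / 12 * a \<le> 23 / 25 * ((1 - p) * a)" if "0 \<le> a" for a
      proof -
        have "1 / 10 * a \<le> (1 - p) * a" using pp that by (intro mult_right_mono) auto
        with that show ?thesis by linarith
      qed
      \<comment> \<open>In these variables the claim is linear. After adding 1/100 of the drifts, m
        and n keep -1 + 8/100 = -23/25, while s and t keep at most -1 + 1/4 + 8/100 + 1/200 <
        0.\<close>
      define m n s t where "m = (1 - p) * a1" and "n = (1 - p) * b2" and "s = p * b1" and "t = p * a2"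
      have "ex \<le> 1 / 4 * t + (1 / 12 * a1 - m) - s"
        using that(1) by (simp add: m_def s_def t_def algebra_simps)
      moreover have "ey \<le> 1 / 4 * s + 1 / 12 * c - n - t"
        using that(3) by (simp add: n_def s_def t_def)
      moreover have "dx \<le> 1 / 2 * t + 8 * (m + s)" "dy \<le> 1 / 2 * s + 8 * (n + t)"
        using that(4,5) by (simp_all add: m_def n_def s_def t_def)
      moreover have "0 \<le> s" "0 \<le> t" using pp that by (auto simp: s_def t_def)
      moreover have "1 / 12 * a1 \<le> 23 / 25 * m" "1 / 12 * b2 \<le> 23 / 25 * n"
        using absorb[of a1] absorb[of b2] that by (auto simp: m_def n_def)
      ultimately show ?thesis using that(2,10) by (simp add: field_simps)
    qed
    then show ?thesis using x_le z_le y_le x_drift y_drift nonneg by blast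
  qed
  finally show "(\<integral>e. 1 / 100 * (norm (x_drift k e))\<^sup>2 + 1 / 100 * (norm (y_drift k e))\<^sup>2
     + (x_error k e + z_error k e + y_error k e) \<partial>M) \<le> 0" .
qed

text \<open>Orthogonality turns the squared drift sums into sums of squares and the offsets have
  mean zero, so the expectation splits into the single steps.\<close>

lemma
  shows integrable_fluctuation: "integrable M (fluctuation K)"
    and expectation_fluctuation: "(\<integral>e. fluctuation K e \<partial>M) \<le> 0"
proof -
  note dx = adapted_square_integrable[OF adapted_x_drift] and dy = adapted_square_integrable[OF adapted_y_drift]
  note sx = square_integrable_norm[OF square_integrable_sum[OF dx, where I = "{..<K}"]]
    and sy = square_integrable_norm[OF square_integrable_sum[OF dy, where I = "{..<K}"]]
  note ints = integrable_x_offset integrable_y_offset integrable_x_error integrable_z_error integrable_y_error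
  have r: "integrable M (residual k)" for k
    unfolding residual_def[abs_def] using ints by simp
  show "integrable M (fluctuation K)"
    unfolding fluctuation_def[abs_def] using sx sy r by simp
  have "(\<integral>e. fluctuation K e \<partial>M) = 1 / 100 * (\<integral>e. (norm (\<Sum>k<K. x_drift k e))\<^sup>2 \<partial>M)
      + 1 / 100 * (\<integral>e. (norm (\<Sum>k<K. y_drift k e))\<^sup>2 \<partial>M) + (\<Sum>k<K. \<integral>e. residual k e \<partial>M)"
    unfolding fluctuation_def using sx sy r by simp
  also have "\<dots> = (\<Sum>k<K. 1 / 100 * (\<integral>e. (norm (x_drift k e))\<^sup>2 \<partial>M)
      + 1 / 100 * (\<integral>e. (norm (y_drift k e))\<^sup>2 \<partial>M) + (\<integral>e. residual k e \<partial>M))"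
    using martingale_sum_sq[OF adapted_x_drift x_drift_orth]
      martingale_sum_sq[OF adapted_y_drift y_drift_orth]
    by (simp add: sum.distrib sum_divide_distrib)
  also have "\<dots> = (\<Sum>k<K. \<integral>e. 1 / 100 * (norm (x_drift k e))\<^sup>2 + 1 / 100 * (norm (y_drift k e))\<^sup>2
     + (x_error k e + z_error k e + y_error k e) \<partial>M)"
    unfolding residual_def
    using ints square_integrable_norm[OF dx] square_integrable_norm[OF dy]
      expectation_x_offset expectation_y_offset by simp
  also have "\<dots> \<le> 0" by (intro sum_nonpos fluctuation_step)
  finally show "(\<integral>e. fluctuation K e \<partial>M) \<le> 0" .
qed

end

section \<open>The gap function\<close>

text \<open>The reciprocal of the minimum is the reciprocal of one of its members, and each such
  reciprocal is one summand of the rate.\<close>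

lemma stepsize_bounds:
  assumes L: "0 < Lr" "0 < Ll" and p: "0 < p" and om: "1 \<le> om" and lam: "0 \<le> lam"
    and \<gamma>: "\<gamma> = stepsize Lr Ll (1 - p) om lam"
  shows "0 < \<gamma>" "\<gamma> \<le> 1 / 4" "\<gamma> * Lr \<le> 1 / 4" "\<gamma> * Ll \<le> 1 / 4" "\<gamma>\<^sup>2 * (om * lam) \<le> p / 16"
    and "1 / (2 * \<gamma>) \<le> 2 * (1 + sqrt (om / p) * sqrt lam + Ll + Lr)"
proof -
  define T where "T = {1, 1 / Lr, 1 / Ll} \<union> (if lam = 0 then {} else {sqrt (p / (om * lam))})"
  have \<gamma>T: "\<gamma> = 1 / 4 * Min T" unfolding \<gamma> stepsize_def T_def by simp
  have fin: "finite T" "T \<noteq> {}" by (auto simp: T_def)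
  have pos: "0 < t" if "t \<in> T" for t
    using that L p om lam by (auto simp: T_def split: if_splits)
  show \<gamma>_pos: "0 < \<gamma>" using pos[OF Min_in[OF fin]] by (simp add: \<gamma>T)
  have le: "\<gamma> \<le> 1 / 4 * t" if "t \<in> T" for t using Min_le[OF fin(1) that] by (simp add: \<gamma>T)
  show "\<gamma> \<le> 1 / 4" using le[of 1] by (simp add: T_def)
  show "\<gamma> * Lr \<le> 1 / 4" using le[of "1 / Lr"] L by (simp add: T_def field_simps)
  show "\<gamma> * Ll \<le> 1 / 4" using le[of "1 / Ll"] L by (simp add: T_def field_simps)
  show "\<gamma>\<^sup>2 * (om * lam) \<le> p / 16"
  proof (cases "lam = 0")
    case False
    with lam om have ol: "0 < om * lam" by simp
    have "\<gamma>\<^sup>2 \<le> (1 / 4 * sqrt (p / (om * lam)))\<^sup>2"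
      using le[of "sqrt (p / (om * lam))"] False \<gamma>_pos by (intro power_mono) (auto simp: T_def)
    also have "\<dots> = p / (16 * (om * lam))"
      using p ol by (simp add: power_mult_distrib power_divide)
    finally show ?thesis using ol by (simp add: field_simps)
  qed (use p in simp)
  have sq: "0 \<le> sqrt (om / p) * sqrt lam" using lam om p by simp
  have "1 / t \<le> 1 + sqrt (om / p) * sqrt lam + Ll + Lr" if "t \<in> T" for t
  proof -
    consider "t = 1" | "t = 1 / Lr" | "t = 1 / Ll" | "lam \<noteq> 0" "t = sqrt (p / (om * lam))"
      using \<open>t \<in> T\<close> by (auto simp: T_def split: if_splits)
    then show ?thesis
    proof cases
      case 4
      then have "1 / t = sqrt (om / p) * sqrt lam"
        by (simp add: real_sqrt_divide real_sqrt_mult)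
      then show ?thesis using L by simp
    qed (use L sq in auto)
  qed
  from this[OF Min_in[OF fin]]
  show "1 / (2 * \<gamma>) \<le> 2 * (1 + sqrt (om / p) * sqrt lam + Ll + Lr)" by (simp add: \<gamma>T)
qed

section \<open>Convexity and first-order bounds of the Lagrangian, properties of the gap\<close>

lemma convex_on_linear_compose:
  assumes "convex_on UNIV f" "linear g" shows "convex_on UNIV (\<lambda>v. f (g v))"
  using assms unfolding convex_on_def by (simp add: linear_add linear_scale)

lemma convex_on_sum_fun:
  assumes "\<And>i. convex_on UNIV (f i)" shows "convex_on UNIV (\<lambda>v. \<Sum>i\<in>I. f i v)"
  by (induction I rule: infinite_finite_induct) (auto intro: assms convex_on_add simp: convex_on_const)

lemma convex_on_affine:
  assumes "linear f" shows "convex_on UNIV (\<lambda>v. c + f v :: real)"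
proof (rule convex_on_add)
  show "convex_on UNIV f" using assms unfolding convex_on_def by (simp add: linear_add linear_scale)
qed (simp add: convex_on_const)

lemma sum_mult_block:
  fixes B :: "real ^ 'd::finite ^ 's" and own :: "'d \<Rightarrow> 'n::finite"
  shows "(\<Sum>i\<in>UNIV. B *v block own i x) = B *v x"
  using linear_sum[OF matrix_vector_mul_linear, of B "\<lambda>i. block own i x" UNIV] by (simp add: sum_block)

locale saddle_problem =
  fixes P :: "('d::finite, 's::finite, 'n::finite) problem" and Lr Ll :: real
  assumes reg_block: "\<And>i. depends_on_block (owner P) i (reg P i)"
    and loss_smooth: "L_smooth Ll (\<lambda>z. loss P z (label P))"
    and loss_convex: "convex_on UNIV (\<lambda>z. loss P z (label P))"
    and reg_smooth: "\<And>i. L_smooth Lr (reg P i)"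
    and reg_convex: "\<And>i. convex_on UNIV (reg P i)"
begin

definition reg_grad :: "real ^ 'd \<Rightarrow> real ^ 'd" where
  "reg_grad x = (\<Sum>i\<in>UNIV. gradient (reg P i) (block (owner P) i x))"

definition loss_grad :: "real ^ 's \<Rightarrow> real ^ 's" where
  "loss_grad = gradient (\<lambda>z. loss P z (label P))"

lemma block_gradient:
  "block (owner P) i (gradient (reg P i) (block (owner P) i x)) = gradient (reg P i) (block (owner P) i x)"
  by (rule block_gradient_depends_on_block[OF reg_block reg_smooth])

lemma L_pos: "0 < Lr" "0 < Ll"
  using loss_smooth reg_smooth by (auto simp: L_smooth_def)

text \<open>The block gradients are orthogonal, so squared increments add up and the sum keeps the
  constant \<open>Lr\<close> of a single regularizer.\<close>

lemma reg_grad_lipschitz: "norm (reg_grad a - reg_grad b) \<le> Lr * norm (a - b)"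
proof -
  let ?B = "block (owner P)"
  have "reg_grad a - reg_grad b
      = (\<Sum>i\<in>UNIV. ?B i (gradient (reg P i) (?B i a) - gradient (reg P i) (?B i b)))"
    unfolding reg_grad_def by (simp add: linear_diff[OF linear_block] block_gradient sum_subtractf)
  from arg_cong[OF this, of "\<lambda>v. (norm v)\<^sup>2"]
  have "(norm (reg_grad a - reg_grad b))\<^sup>2
      = (\<Sum>i\<in>UNIV. (norm (gradient (reg P i) (?B i a) - gradient (reg P i) (?B i b)))\<^sup>2)"
    unfolding norm_sum_block_fun by (simp add: linear_diff[OF linear_block] block_gradient norm_sum_block_fun)
  also have "\<dots> \<le> (\<Sum>i\<in>UNIV. (Lr * norm (?B i a - ?B i b))\<^sup>2)"
    using reg_smooth by (intro sum_mono power_mono) (auto simp: L_smooth_def)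
  also have "\<dots> = (Lr * norm (a - b))\<^sup>2"
    by (simp add: power_mult_distrib sum_norm_block linear_diff[OF linear_block, symmetric]
        flip: sum_distrib_left)
  finally show ?thesis using L_pos by (intro power2_le_imp_le[of "norm _"]) auto
qed

lemma loss_grad_lipschitz: "norm (loss_grad a - loss_grad b) \<le> Ll * norm (a - b)"
  using loss_smooth by (simp add: L_smooth_def loss_grad_def)

lemma lagrangian_eq:
  "lagrangian P x z y = loss P z (label P) + (\<Sum>i\<in>UNIV. reg P i (block (owner P) i x))
     + y \<bullet> (features P *v x - z)"
  by (simp add: lagrangian_def sum_mult_block)

text \<open>Convexity is spent on the loss and the regularizers only. For the bilinear coupling,
  evaluated at crossed pairs of points, the bound is an equality.\<close>

lemma lagrangian_diff_le:
  "lagrangian P x z Y - lagrangian P X Z y \<le> (transpose (features P) *v y + reg_grad x) \<bullet> (x - X)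
     + (loss_grad z - y) \<bullet> (z - Z) + (z - features P *v x) \<bullet> (y - Y)"
proof -
  let ?B = "block (owner P)"
  have "loss P z (label P) - loss P Z (label P) \<le> loss_grad z \<bullet> (z - Z)"
    using convex_gradient_inequality[OF loss_convex L_smooth_GDERIV[OF loss_smooth], of z Z]
    by (simp add: loss_grad_def inner_diff_right)
  moreover have "(\<Sum>i\<in>UNIV. reg P i (?B i x)) - (\<Sum>i\<in>UNIV. reg P i (?B i X)) \<le> reg_grad x \<bullet> (x - X)"
  proof -
    have "reg P i (?B i x) - reg P i (?B i X) \<le> gradient (reg P i) (?B i x) \<bullet> (x - X)" for i
    proof -
      have "gradient (reg P i) (?B i x) \<bullet> (x - X) = gradient (reg P i) (?B i x) \<bullet> (?B i x - ?B i X)"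
        by (metis block_gradient inner_block linear_diff linear_block)
      then show ?thesis
        using convex_gradient_inequality[OF reg_convex L_smooth_GDERIV[OF reg_smooth], of i "?B i x" "?B i X"]
        by (simp add: inner_diff_right)
    qed
    then show ?thesis
      unfolding reg_grad_def inner_sum_left sum_subtractf[symmetric] by (rule sum_mono)
  qed
  moreover have "Y \<bullet> (features P *v x - z) - y \<bullet> (features P *v X - Z)
      = (transpose (features P) *v y) \<bullet> (x - X) - y \<bullet> (z - Z) + (z - features P *v x) \<bullet> (y - Y)"
    unfolding inner_diff_right inner_diff_left adjoint_transpose_inner by (simp add: inner_commute)
  ultimately show ?thesis
    unfolding lagrangian_eq inner_add_left inner_diff_left[of "loss_grad z"] by linarith
qed

text \<open>Joint convexity serves twice: for averaging, and because in finite dimension it implies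
  continuity, which makes the infimum over the compact set finite.\<close>

lemma lagrangian_convex: "convex_on UNIV (\<lambda>(x, z). lagrangian P x z y)"
proof -
  have "convex_on UNIV (\<lambda>v. loss P (snd v) (label P))"
    by (rule convex_on_linear_compose[OF loss_convex linear_snd])
  moreover have "convex_on UNIV (\<lambda>v. \<Sum>i\<in>UNIV. reg P i (block (owner P) i (fst v)))"
  proof (rule convex_on_sum_fun)
    show "convex_on UNIV (\<lambda>v. reg P i (block (owner P) i (fst v)))" for i
      by (rule convex_on_linear_compose[OF reg_convex linear_compose[OF linear_fst linear_block, unfolded comp_def]])
  qed
  moreover have "convex_on UNIV (\<lambda>v. 0 + y \<bullet> (features P *v fst v - snd v))"
    by (intro convex_on_affine linearI)
      (auto simp: inner_simps matrix_vector_right_distrib matrix_vector_mult_scaleR algebra_simps)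
  ultimately show ?thesis unfolding lagrangian_eq case_prod_beta' by (intro convex_on_add) auto
qed

context
  fixes X :: "(real ^ 'd) set" and Z Y :: "(real ^ 's) set"
  assumes compact: "compact X" "compact Z" "compact Y" and nonempty: "X \<noteq> {}" "Z \<noteq> {}" "Y \<noteq> {}"
begin

lemma gap_upper:
  assumes "x' \<in> X" "z' \<in> Z" "y' \<in> Y"
  shows "lagrangian P x z y' - lagrangian P x' z' y \<le> gap P X Z Y x z y"
proof -
  have "compact ((\<lambda>y'. lagrangian P x z y') ` Y)"
    unfolding lagrangian_eq by (intro compact_continuous_image continuous_intros compact)
  then have "lagrangian P x z y' \<le> (SUP y'\<in>Y. lagrangian P x z y')"
    using assms by (intro cSUP_upper bounded_imp_bdd_above compact_imp_bounded)
  moreover have "continuous_on UNIV (\<lambda>(x', z'). lagrangian P x' z' y)"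
    by (rule convex_on_continuous[OF open_UNIV lagrangian_convex])
  then have "compact ((\<lambda>(x', z'). lagrangian P x' z' y) ` (X \<times> Z))"
    by (intro compact_continuous_image compact_Times compact) (auto elim: continuous_on_subset)
  then have "(INF (x', z')\<in>X \<times> Z. lagrangian P x' z' y) \<le> (\<lambda>(x', z'). lagrangian P x' z' y) (x', z')"
    using assms by (intro cINF_lower bounded_imp_bdd_below compact_imp_bounded) auto
  ultimately show ?thesis unfolding gap_def by simp
qed

text \<open>With \<open>gap_upper\<close> this characterises the gap as the least upper bound of
  Lagrangian differences. Supremum and infimum run over separate variables, so they can be
  eliminated one after the other.\<close>

lemma gap_least:
  assumes "\<And>x' z' y'. \<lbrakk>x' \<in> X; z' \<in> Z; y' \<in> Y\<rbrakk> \<Longrightarrow> lagrangian P x z y' - lagrangian P x' z' y \<le> c"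
  shows "gap P X Z Y x z y \<le> c"
proof -
  have le: "(SUP y'\<in>Y. lagrangian P x z y') \<le> c + lagrangian P x' z' y" if "x' \<in> X" "z' \<in> Z" for x' z'
  proof (rule cSUP_least[OF nonempty(3)])
    fix y' assume "y' \<in> Y"
    then show "lagrangian P x z y' \<le> c + lagrangian P x' z' y" using assms[OF that] by fastforce
  qed
  have "(SUP y'\<in>Y. lagrangian P x z y') - c \<le> (INF (x', z')\<in>X \<times> Z. lagrangian P x' z' y)"
  proof (intro cINF_greatest)
    fix v assume "v \<in> X \<times> Z"
    then have "(SUP y'\<in>Y. lagrangian P x z y') \<le> c + lagrangian P (fst v) (snd v) y"
      by (intro le) auto
    then show "(SUP y'\<in>Y. lagrangian P x z y') - c \<le> (case v of (x', z') \<Rightarrow> lagrangian P x' z' y)"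
      unfolding case_prod_beta' by linarith
  qed (use nonempty in simp)
  then show ?thesis unfolding gap_def by simp
qed

lemma lagrangian_difference_convex:
  "convex_on UNIV (\<lambda>(x, z, y). lagrangian P x z y' - lagrangian P x' z' y)"
proof -
  have "linear (\<lambda>v :: (real^'d) \<times> (real^'s) \<times> (real^'s). (fst v, fst (snd v)))"
    by (intro linearI) auto
  from convex_on_linear_compose[OF lagrangian_convex this]
  have f: "convex_on UNIV (\<lambda>v :: (real^'d) \<times> (real^'s) \<times> (real^'s). lagrangian P (fst v) (fst (snd v)) y')" by simp
  have g: "convex_on UNIV (\<lambda>v :: (real^'d) \<times> (real^'s) \<times> (real^'s).
      - (loss P z' (label P) + (\<Sum>i\<in>UNIV. reg P i (block (owner P) i x')))
      + - (snd (snd v) \<bullet> (features P *v x' - z')))"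
    by (intro convex_on_affine linearI) (auto simp: inner_simps algebra_simps)
  have "(\<lambda>(x, z, y). lagrangian P x z y' - lagrangian P x' z' y)
      = (\<lambda>v. lagrangian P (fst v) (fst (snd v)) y'
        + (- (loss P z' (label P) + (\<Sum>i\<in>UNIV. reg P i (block (owner P) i x')))
           + - (snd (snd v) \<bullet> (features P *v x' - z'))))"
    unfolding lagrangian_eq[of x' z'] case_prod_beta' by (intro ext) linarith
  with convex_on_add[OF f g] show ?thesis by simp
qed

text \<open>A supremum of convex functions is convex. The aim is measurability of the random gap: a
  finite convex function on a finite-dimensional space is continuous.\<close>

lemma gap_convex: "convex_on UNIV (\<lambda>(x, z, y). gap P X Z Y x z y)"
proof (rule convex_onI)
  fix t :: real and v w :: "(real^'d) \<times> (real^'s) \<times> (real^'s)"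
  assume t: "0 < t" "t < 1"
  obtain x z y where v: "v = (x, z, y)" by (cases v)
  obtain x1 z1 y1 where w: "w = (x1, z1, y1)" by (cases w)
  let ?g = "\<lambda>(x, z, y). gap P X Z Y x z y"
  have "gap P X Z Y ((1 - t) *\<^sub>R x + t *\<^sub>R x1) ((1 - t) *\<^sub>R z + t *\<^sub>R z1) ((1 - t) *\<^sub>R y + t *\<^sub>R y1)
      \<le> (1 - t) * gap P X Z Y x z y + t * gap P X Z Y x1 z1 y1"
  proof (rule gap_least)
    fix x' z' y' assume m: "x' \<in> X" "z' \<in> Z" "y' \<in> Y"
    have "lagrangian P ((1 - t) *\<^sub>R x + t *\<^sub>R x1) ((1 - t) *\<^sub>R z + t *\<^sub>R z1) y'
        - lagrangian P x' z' ((1 - t) *\<^sub>R y + t *\<^sub>R y1)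
        \<le> (1 - t) * (lagrangian P x z y' - lagrangian P x' z' y)
          + t * (lagrangian P x1 z1 y' - lagrangian P x' z' y1)"
      using convex_onD[OF lagrangian_difference_convex, of t v w y' x' z'] t by (simp add: v w)
    also have "\<dots> \<le> (1 - t) * gap P X Z Y x z y + t * gap P X Z Y x1 z1 y1"
      using t by (intro add_mono mult_left_mono gap_upper m) auto
    finally show "lagrangian P ((1 - t) *\<^sub>R x + t *\<^sub>R x1) ((1 - t) *\<^sub>R z + t *\<^sub>R z1) y'
        - lagrangian P x' z' ((1 - t) *\<^sub>R y + t *\<^sub>R y1)
      \<le> (1 - t) * gap P X Z Y x z y + t * gap P X Z Y x1 z1 y1" .
  qed
  then show "?g ((1 - t) *\<^sub>R v + t *\<^sub>R w) \<le> (1 - t) * ?g v + t * ?g w" by (simp add: v w)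
qed simp

lemma gap_measurable:
  assumes "x \<in> borel_measurable M" "z \<in> borel_measurable M" "y \<in> borel_measurable M"
  shows "(\<lambda>e. gap P X Z Y (x e) (z e) (y e)) \<in> borel_measurable M"
proof -
  have g: "(\<lambda>(x, z, y). gap P X Z Y x z y) \<in> borel_measurable borel"
    by (intro borel_measurable_continuous_onI convex_on_continuous[OF open_UNIV gap_convex])
  have "(\<lambda>e. (x e, z e, y e)) \<in> borel_measurable M"
    using assms by (intro borel_measurable_Pair)
  from measurable_compose[OF this g] show ?thesis by simp
qed

text \<open>Jensen in the joint variable (x, z, y). The subtracted Lagrangian depends on y in an
  affine way, so its sign does no harm.\<close>

lemma lagrangian_difference_average:
  assumes "0 < K"
  shows "lagrangian P (average K x) (average K z) y' - lagrangian P x' z' (average K y)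
    \<le> (1 / real K) * (\<Sum>k<K. lagrangian P (x k) (z k) y' - lagrangian P x' z' (y k))"
proof -
  let ?f = "\<lambda>(x, z, y). lagrangian P x z y' - lagrangian P x' z' y"
  have "?f (\<Sum>k<K. (1 / real K) *\<^sub>R (x k, z k, y k)) \<le> (\<Sum>k<K. (1 / real K) * ?f (x k, z k, y k))"
    using assms by (intro convex_on_sum[OF _ _ lagrangian_difference_convex]) auto
  moreover have "(\<Sum>k<K. (1 / real K) *\<^sub>R (x k, z k, y k)) = (average K x, average K z, average K y)"
    by (simp add: average_def prod_eq_iff fst_sum snd_sum scaleR_sum_right)
  ultimately show ?thesis by (simp add: sum_distrib_left)
qed

lemma sq_dist_le_max:
  assumes "x \<in> X" "z \<in> Z" "y \<in> Y"
  shows "(norm (x0 - x))\<^sup>2 + (norm (z0 - z))\<^sup>2 + (norm (y0 - y))\<^sup>2 \<le> max_sq_dist X Z Y x0 z0 y0"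
proof -
  let ?f = "\<lambda>(x, z, y). (norm (x0 - x))\<^sup>2 + (norm (z0 - z))\<^sup>2 + (norm (y0 - y))\<^sup>2"
  have "compact (?f ` (X \<times> Z \<times> Y))"
    unfolding case_prod_beta' by (intro compact_continuous_image compact_Times compact continuous_intros)
  then have "?f (x, z, y) \<le> Sup (?f ` (X \<times> Z \<times> Y))"
    using assms by (intro cSUP_upper bounded_imp_bdd_above compact_imp_bounded) auto
  then show ?thesis by (simp add: max_sq_dist_def)
qed

end
end

text \<open>The O-constant is explicit. The potential also contains the distances of the initial
  anchors from the comparator, which \<open>D2\<close> does not see; \<open>R\<close> measures their
  displacement relative to \<open>D2\<close>, and \<open>R = 0\<close> is admissible when the
  anchors start at x0 and y0.\<close>

theorem theorem3:
  fixes P :: "('d::finite, 's::finite, 'n::finite) problem"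
    and X :: "(real ^ 'd) set" and Z Y :: "(real ^ 's) set"
    and M :: "'w measure" and S :: "'q measure"
    and Q :: "'q \<Rightarrow> real ^ 's \<Rightarrow> real ^ 's"
    and bc :: "nat \<Rightarrow> 'w \<Rightarrow> 'q" and up :: "nat \<Rightarrow> 'n \<Rightarrow> 'w \<Rightarrow> 'q" and coin :: "nat \<Rightarrow> 'w \<Rightarrow> bool"
    and Lr Ll om p \<tau> \<gamma> lam D2 R :: real and K :: nat
    and x0 w0 :: "real ^ 'd" and z0 y0 u0 :: "real ^ 's"
    and traj :: "'w \<Rightarrow> nat \<Rightarrow> ('d, 's) state"
  defines "lam \<equiv> lambda_max (features P ** transpose (features P))"
    and "D2 \<equiv> max_sq_dist X Z Y x0 z0 y0"
    and "traj \<equiv> (\<lambda>e. iterate P \<tau> \<gamma> (\<lambda>k. Q (bc k e)) (\<lambda>k i. Q (up k i e)) (\<lambda>k. coin k e)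
                       \<lparr> xs = x0, zs = z0, ys = y0, ws = w0, us = u0 \<rparr>)"
  assumes "surj (owner P)"
    and "\<And>i. depends_on_block (owner P) i (reg P i)"
    and "L_smooth Ll (\<lambda>z. loss P z (label P))"
    and "convex_on UNIV (\<lambda>z. loss P z (label P))"
    and "\<And>i. L_smooth Lr (reg P i)"
    and "\<And>i. convex_on UNIV (reg P i)"
    and "compact X" "X \<noteq> {}" and "compact Z" "Z \<noteq> {}" and "compact Y" "Y \<noteq> {}"
    and "unbiased_compressor S Q om"
    and "algorithm_randomness M S p bc up coin"
    and "0 < p" and "p \<le> 9 / 10"
    and "\<tau> = 1 - p"
    and "\<gamma> = stepsize Lr Ll \<tau> om lam"
    and "0 < K"
    and "0 \<le> R" and "(norm (w0 - x0))\<^sup>2 + (norm (u0 - y0))\<^sup>2 \<le> R * D2"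
  shows "integrable M (\<lambda>e. gap P X Z Y
             (average K (\<lambda>k. x_half P \<tau> \<gamma> (traj e k)))
             (average K (\<lambda>k. z_half P \<gamma> (traj e k)))
             (average K (\<lambda>k. y_half P \<tau> \<gamma> (traj e k)))) \<and>
         (\<integral>e. gap P X Z Y
             (average K (\<lambda>k. x_half P \<tau> \<gamma> (traj e k)))
             (average K (\<lambda>k. z_half P \<gamma> (traj e k)))
             (average K (\<lambda>k. y_half P \<tau> \<gamma> (traj e k))) \<partial>M)
         \<le> 1000 * (1 + R) * (1 + sqrt (om / p) * sqrt lam + Ll + Lr) * (D2 / real K)"
proof -
  interpret saddle_problem P Lr Ll
  proof unfold_locales
    show "depends_on_block (owner P) i (reg P i)" "L_smooth Lr (reg P i)" "convex_on UNIV (reg P i)" for i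
      by fact+
  qed fact+
  interpret compression_noise M S Q om p bc up coin
    by unfold_locales fact+
  let ?F = "features P" and ?B = "block (owner P)"
  have lam: "0 \<le> lam" unfolding lam_def by (rule lambda_max_nonneg)
  note step = stepsize_bounds[OF L_pos \<open>0 < p\<close> om_ge_1 lam \<open>\<gamma> = stepsize Lr Ll \<tau> om lam\<close>[unfolded \<open>\<tau> = 1 - p\<close>]]
  define xh where "xh k e = x_half P \<tau> \<gamma> (traj e k)" for k e
  define zh where "zh k e = z_half P \<gamma> (traj e k)" for k e
  define yh where "yh k e = y_half P \<tau> \<gamma> (traj e k)" for k e
  note half = x_half_def y_half_def z_half_def reg_grad_def[symmetric] loss_grad_def[symmetric]
    sum.distrib sum_block sum_mult_block \<open>\<tau> = 1 - p\<close>
  interpret compressed_extragradient M S Q om p bc up coin "\<lambda>i a. ?F *v ?B i a" "(*v) (transpose ?F)"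
    reg_grad loss_grad Lr Ll lam \<gamma> "\<lambda>k e. xs (traj e k)" "\<lambda>k e. ws (traj e k)" xh
    "\<lambda>k e. zs (traj e k)" "\<lambda>k e. ys (traj e k)" "\<lambda>k e. us (traj e k)" zh yh x0 w0 z0 y0 u0
  proof (intro compressed_extragradient.intro compressed_extragradient_axioms.intro)
    show "compression_noise M S Q om p bc up coin" by (rule compression_noise_axioms)
    show "linear (\<lambda>a. ?F *v ?B i a)" for i
      using linear_compose[OF linear_block matrix_vector_mul_linear] by (simp add: comp_def)
    show "linear ((*v) (transpose ?F))" by (rule matrix_vector_mul_linear)
    show "(transpose ?F *v v) \<bullet> a = v \<bullet> (\<Sum>i\<in>UNIV. ?F *v ?B i a)" for v a
      unfolding sum_mult_block by (rule adjoint_transpose_inner)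
    show "(norm (transpose ?F *v v))\<^sup>2 \<le> lam * (norm v)\<^sup>2" for v
      unfolding lam_def by (rule norm_transpose_mult_le)
    show "(norm (\<Sum>i\<in>UNIV. ?F *v ?B i a))\<^sup>2 \<le> lam * (norm a)\<^sup>2" for a
      unfolding lam_def sum_mult_block by (rule norm_matrix_mult_le)
    show "(\<Sum>i\<in>UNIV. (norm (?F *v ?B i a))\<^sup>2) \<le> lam * (norm a)\<^sup>2" for a
    proof -
      \<comment> \<open>Each block is bounded by the full matrix applied to a vector supported
        there; the squared block norms then add up exactly.\<close>
      have "(\<Sum>i\<in>UNIV. (norm (?F *v ?B i a))\<^sup>2) \<le> (\<Sum>i\<in>UNIV. lam * (norm (?B i a))\<^sup>2)"
        unfolding lam_def by (intro sum_mono norm_matrix_mult_le)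
      then show ?thesis by (simp add: sum_norm_block flip: sum_distrib_left)
    qed
    show "xh k e = (1 - p) *\<^sub>R xs (traj e k) + p *\<^sub>R ws (traj e k)
        - \<gamma> *\<^sub>R (transpose ?F *v us (traj e k) + reg_grad (xs (traj e k)))" for k e
      unfolding xh_def half by simp
    show "zh k e = zs (traj e k) - \<gamma> *\<^sub>R (loss_grad (zs (traj e k)) - ys (traj e k))" for k e
      unfolding zh_def half by simp
    show "yh k e = (1 - p) *\<^sub>R ys (traj e k) + p *\<^sub>R us (traj e k)
        + \<gamma> *\<^sub>R ((\<Sum>i\<in>UNIV. ?F *v ?B i (ws (traj e k))) - zs (traj e k))" for k e
      unfolding yh_def half by simp
    have Suc: "traj e (Suc k) = next_state P \<tau> \<gamma> (Q (bc k e)) (\<lambda>i. Q (up k i e)) (coin k e) (traj e k)" for e k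
      by (simp add: traj_def)
    show "xs (traj e (Suc k)) = (1 - p) *\<^sub>R xs (traj e k) + p *\<^sub>R ws (traj e k)
        - \<gamma> *\<^sub>R (transpose ?F *v (Q (bc k e) (yh k e - us (traj e k)) + us (traj e k)) + reg_grad (xh k e))" for k e
      unfolding Suc next_state_def Let_def by (simp add: sum.distrib sum_block xh_def yh_def reg_grad_def \<open>\<tau> = 1 - p\<close>)
    show "zs (traj e (Suc k)) = zs (traj e k) - \<gamma> *\<^sub>R (loss_grad (zh k e) - yh k e)" for k e
      unfolding Suc next_state_def Let_def by (simp add: zh_def yh_def loss_grad_def)
    show "ys (traj e (Suc k)) = (1 - p) *\<^sub>R ys (traj e k) + p *\<^sub>R us (traj e k)
        + \<gamma> *\<^sub>R ((\<Sum>i\<in>UNIV. Q (up k i e) (?F *v ?B i (xh k e - ws (traj e k))) + ?F *v ?B i (ws (traj e k)))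
          - zh k e)" for k e
      unfolding Suc next_state_def Let_def
      by (simp add: xh_def zh_def linear_diff[OF linear_block] matrix_vector_mult_diff_distrib \<open>\<tau> = 1 - p\<close>)
    show "ws (traj e (Suc k)) = (if coin k e then xs (traj e k) else ws (traj e k))"
      "us (traj e (Suc k)) = (if coin k e then ys (traj e k) else us (traj e k))" for k e
      unfolding Suc next_state_def Let_def by simp_all
  qed (use lam assms step L_pos reg_grad_lipschitz loss_grad_lipschitz in \<open>auto simp: traj_def\<close>)

  let ?xa = "\<lambda>e. average K (\<lambda>k. xh k e)" and ?za = "\<lambda>e. average K (\<lambda>k. zh k e)"
    and ?ya = "\<lambda>e. average K (\<lambda>k. yh k e)"
  define G where "G e = gap P X Z Y (?xa e) (?za e) (?ya e)" for e
  \<comment> \<open>A majorant of the gap for each outcome: the comparator is already eliminated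
    through \<open>D2\<close>, so its expectation involves only \<open>fluctuation\<close>.\<close>
  define C where "C e = ((28 + 2 * R) * D2 + fluctuation K e) / (2 * \<gamma> * real K)" for e
  have XZY: "compact X" "compact Z" "compact Y" "X \<noteq> {}" "Z \<noteq> {}" "Y \<noteq> {}" by fact+
  have avg: "square_integrable M ?xa" "square_integrable M ?za" "square_integrable M ?ya"
    unfolding average_def
    by (intro square_integrable_scaleR square_integrable_sum
        adapted_iterates(6-8)[THEN adapted_square_integrable])+

  have upper: "G e \<le> C e" for e
    unfolding G_def
  proof (rule gap_least[OF XZY])
    fix x z y assume m: "x \<in> X" "z \<in> Z" "y \<in> Y"
    have "lagrangian P (?xa e) (?za e) y - lagrangian P x z (?ya e)
        \<le> 1 / real K * (\<Sum>k<K. lagrangian P (xh k e) (zh k e) y - lagrangian P x z (yh k e))"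
      by (rule lagrangian_difference_average[OF XZY \<open>0 < K\<close>])
    also have "\<dots> \<le> 1 / real K * (\<Sum>k<K. linearized_gap k e x z y)"
      using lagrangian_diff_le unfolding linearized_gap_def sum_mult_block
      by (intro mult_left_mono sum_mono) auto
    also have "\<dots> = (2 * \<gamma> * (\<Sum>k<K. linearized_gap k e x z y)) / (2 * \<gamma> * real K)"
      using step(1) by simp
    also have "\<dots> \<le> C e"
      unfolding C_def
    proof (rule divide_right_mono)
      have "a \<le> (28 + 2 * R) * D2 + f" if "a \<le> 28 * n + 2 * m + f" "n \<le> D2" "m \<le> R * D2" for a n m f
        using that by (simp add: algebra_simps)
      moreover have "(norm (x0 - x))\<^sup>2 + (norm (z0 - z))\<^sup>2 + (norm (y0 - y))\<^sup>2 \<le> D2"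
        unfolding D2_def by (rule sq_dist_le_max[OF XZY m])
      ultimately show "2 * \<gamma> * (\<Sum>k<K. linearized_gap k e x z y) \<le> (28 + 2 * R) * D2 + fluctuation K e"
        using linearized_gap_sum_le \<open>(norm (w0 - x0))\<^sup>2 + (norm (u0 - y0))\<^sup>2 \<le> R * D2\<close> by blast
    qed (use step(1) in simp)
    finally show "lagrangian P (?xa e) (?za e) y - lagrangian P x z (?ya e) \<le> C e" .
  qed

  obtain x z y where m: "x \<in> X" "z \<in> Z" "y \<in> Y" using XZY by blast
  \<comment> \<open>Integrability also needs a lower bound. At a fixed comparator the convexity
    inequality with gradients taken at that point gives a minorant affine in the averages, which are
    square integrable.\<close>
  define c where "c e = (y - ?ya e) \<bullet> (?F *v x - z)
    - (transpose ?F *v y + reg_grad x) \<bullet> (x - ?xa e) - (loss_grad z - y) \<bullet> (z - ?za e)" for e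
  have lower: "c e \<le> G e" for e
  proof -
    have "lagrangian P x z y - lagrangian P (?xa e) (?za e) y
        \<le> (transpose ?F *v y + reg_grad x) \<bullet> (x - ?xa e) + (loss_grad z - y) \<bullet> (z - ?za e)"
      using lagrangian_diff_le[of x z y "?xa e" "?za e" y] by simp
    moreover have "lagrangian P x z y - lagrangian P x z (?ya e) = (y - ?ya e) \<bullet> (?F *v x - z)"
      unfolding lagrangian_eq by (simp add: inner_diff_left)
    ultimately show ?thesis
      using gap_upper[OF XZY m, of "?xa e" "?za e" "?ya e"] unfolding c_def G_def by linarith
  qed
  have c_int: "integrable M c"
    unfolding c_def
    by (intro Bochner_Integration.integrable_diff square_integrable_inner square_integrable_diff
        square_integrable_const avg)
  have C_int: "integrable M C" unfolding C_def using integrable_fluctuation by simp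
  have G_int: "integrable M G"
  proof (rule Bochner_Integration.integrable_bound)
    show "integrable M (\<lambda>e. \<bar>c e\<bar> + \<bar>C e\<bar>)" using c_int C_int by simp
    show "G \<in> borel_measurable M"
      unfolding G_def by (intro gap_measurable[OF XZY] square_integrable_measurable avg)
    show "AE e in M. norm (G e) \<le> norm (\<bar>c e\<bar> + \<bar>C e\<bar>)"
    proof (rule AE_I2)
      fix e show "norm (G e) \<le> norm (\<bar>c e\<bar> + \<bar>C e\<bar>)" using lower[of e] upper[of e] by simp
    qed
  qed
  have D2: "0 \<le> D2"
    using sq_dist_le_max[OF XZY m, of x0 z0 y0] unfolding D2_def
    by (meson add_nonneg_nonneg order_trans zero_le_power2)
  let ?c = "1 + sqrt (om / p) * sqrt lam + Ll + Lr"
  have "(\<integral>e. G e \<partial>M) \<le> (\<integral>e. C e \<partial>M)" by (intro integral_mono G_int C_int upper)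
  also have "\<dots> = ((28 + 2 * R) * D2 + (\<integral>e. fluctuation K e \<partial>M)) / (2 * \<gamma> * real K)"
    unfolding C_def using integrable_fluctuation by (simp add: prob_space)
  also have "\<dots> \<le> ((28 + 2 * R) * D2) / (2 * \<gamma> * real K)"
    using expectation_fluctuation[of K] step(1) by (intro divide_right_mono) auto
  also have "\<dots> = 1 / (2 * \<gamma>) * ((28 + 2 * R) * (D2 / real K))" by simp
  also have "\<dots> \<le> (2 * ?c) * ((28 + 2 * R) * (D2 / real K))"
    using step(6) D2 \<open>0 \<le> R\<close> by (intro mult_right_mono) auto
  also have "\<dots> = ?c * (D2 / real K) * (56 + 4 * R)" by (simp add: algebra_simps)
  \<comment> \<open>Here 56 + 4 R is twice 28 + 2 R, the 2 coming from the bound on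
    \<open>1 / (2 * \<gamma>)\<close>; the factor 1000 is a round majorant.\<close>
  also have "\<dots> \<le> ?c * (D2 / real K) * (1000 * (1 + R))"
  proof (rule mult_left_mono)
    have "0 \<le> ?c" using lam \<open>0 < p\<close> om_ge_1 L_pos by simp
    then show "0 \<le> ?c * (D2 / real K)" using D2 by simp
  qed (use \<open>0 \<le> R\<close> in simp)
  finally have "(\<integral>e. G e \<partial>M) \<le> 1000 * (1 + R) * ?c * (D2 / real K)" by (simp only: ac_simps)
  with G_int show ?thesis unfolding G_def xh_def zh_def yh_def by simp
qed

end
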